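(* Let $(b,\sigma)$ be forward-Lipschitz and $(g,f)$ monotone of growth $m\ge1$ (as defined in the context), let $\theta\in[1/2,1]$ and $h=T/N\le\min\{1,[4\theta(L_y+3d\theta L_z^2)]^{-1}\}$. Let $\{(Y_i,Z_i)\}_{i=0,\dots,N}$ be the output of the $\theta$-scheme. Then for any $p\ge1$ there exists a constant $c$ (independent of $h$ and $N$) such that $$\max_{i=0,\dots,N}\mathbb E\big[|Y_i|^{2p}\big]+\sum_{i=0}^{N-1}\mathbb E\big[(|Z_i|^2h)^p\big]\le c\big(1+\mathbb E[|X_N|^{2mp}]\big).$$
   Context: Setting. Fix $T>0$, $d,k\in\mathbb N$, a complete probability space with a $d$-dimensional Brownian motion $W$ on $[0,T]$ and its augmented natural filtration $(\mathcal F_t)$. For $x\in\mathbb R^d$ let $X_s=x+\int_0^sb(r,X_r)dr+\int_0^s\sigma(r,X_r)dW_r$ ($X$ valued in $\mathbb R^d$). Forward-Lipschitz: $b:[0,T]\times\mathbb R^d\to\mathbb R^d$ and $\sigma:[0,T]\times\mathbb R^d\to\mathbb R^{d\times d}$ are $1/2$-Hölder in time, Lipschitz in space, with $b(\cdot,0),\sigma(\cdot,0)$ bounded. Monotone of growth $m\ge1$: $g:\mathbb R^d\to\mathbb R^k$ is Lipschitz (of linear growth), $f:[0,T]\times\mathbb R^d\times\mathbb R^k\times\mathbb R^{k\times d}\to\mathbb R^k$ is continuous, and there are constants $L,L_t,L_x,L_y,L_z>0$ such that for all arguments: $|f(t,x,y,z)|\le L+L_x|x|+L_y|y|^m+L_z\|z\|$;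 $\langle y'-y,f(t,x,y',z)-f(t,x,y,z)\rangle\le L_y|y'-y|^2$; $|f(t,x,y,z)-f(t',x',y,z')|\le L_t|t-t'|^{1/2}+L_x|x-x'|+L_z\|z-z'\|$. Grid: $t_i=ih$, $i=0,\dots,N$, $h=T/N$; $\Delta W_{i+1}=W_{t_{i+1}}-W_{t_i}$; $\mathbb E_i[\cdot]=\mathbb E[\cdot|\mathcal F_{t_i}]$. Approximation of $X$: for each $N$ a family $\{X_i\}_{i=0,\dots,N}$ is given, $X_i$ being $\mathcal F_{t_i}$-measurable, such that for some $\gamma\ge1/2$ and every $p\ge2$ there is a constant $c$ independent of $N$ with $\max_i\mathbb E[|X_i|^p]\le c$ and $\max_i\mathbb E[|X_{t_i}-X_i|^p]^{1/p}\le ch^\gamma$. $\theta$-scheme: $Y_N=g(X_N)$, $Z_N=0$ and for $i=N-1,\dots,0$ $$Z_i=\mathbb E_i\Big[\tfrac{\Delta W_{i+1}}{h}\big(Y_{i+1}+(1-\theta)f(t_{i+1},X_{i+1},Y_{i+1},Z_{i+1})h\big)\Big],$$ $$Y_i=\mathbb E_i\big[Y_{i+1}+(1-\theta)f(t_{i+1},X_{i+1},Y_{i+1},Z_{i+1})h\big]+\theta f(t_i,X_i,Y_i,Z_i)h,$$ where for an $\mathbb R^k$-valued $A$ the product $\Delta W_{i+1}A$ is read as the $k\times d$ matrix $A(\Delta W_{i+1})^*$. For $\theta>0$ and $h<1/(\theta L_y)$ the implicit equation for $Y_i$ has a unique solution. *)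

theory Defs
  imports "HOL-Probability.Probability"
begin

section \<open>Brownian motion and its augmented filtration\<close>

definition brownian_motion :: "'a measure \<Rightarrow> real \<Rightarrow> (real \<Rightarrow> 'a \<Rightarrow> real^'d) \<Rightarrow> bool" where
  "brownian_motion M T W \<longleftrightarrow>
     (\<forall>t\<in>{0..T}. W t \<in> borel_measurable M) \<and>
     (AE \<omega> in M. W 0 \<omega> = 0) \<and>
     (AE \<omega> in M. continuous_on {0..T} (\<lambda>t. W t \<omega>)) \<and>
     (\<forall>n (t :: nat \<Rightarrow> real). (\<forall>i\<le>n. t i \<in> {0..T}) \<longrightarrow> (\<forall>i<n. t i \<le> t (Suc i)) \<longrightarrow>
        prob_space.indep_vars M (\<lambda>_. borel) (\<lambda>i \<omega>. W (t (Suc i)) \<omega> - W (t i) \<omega>) {..<n}) \<and>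
     (\<forall>s\<in>{0..T}. \<forall>t\<in>{0..T}. s < t \<longrightarrow>
        prob_space.indep_vars M (\<lambda>_. borel) (\<lambda>j \<omega>. (W t \<omega> - W s \<omega>) $ j) (UNIV :: 'd set) \<and>
        (\<forall>j. distributed M lborel (\<lambda>\<omega>. (W t \<omega> - W s \<omega>) $ j)
                (\<lambda>x. ennreal (normal_density 0 (sqrt (t - s)) x))))"

definition aug_filtration :: "'a measure \<Rightarrow> (real \<Rightarrow> 'a \<Rightarrow> real^'d) \<Rightarrow> real \<Rightarrow> 'a measure" where
  "aug_filtration M W t =
     sigma (space M) ({W s -` B \<inter> space M | s B. s \<in> {0..t} \<and> B \<in> sets borel} \<union> null_sets M)"

section \<open>The stochastic integral and the forward equation\<close>

text \<open>Convergence to zero in probability of nonnegative, possibly infinite random variables.  The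
  outer measure agrees with \<^term>\<open>emeasure M\<close> on measurable events, and avoids that a nonmeasurable
  event is given the value zero.\<close>

definition tends_to_0_in_prob :: "'a measure \<Rightarrow> (nat \<Rightarrow> 'a \<Rightarrow> ennreal) \<Rightarrow> bool" where
  "tends_to_0_in_prob M R \<longleftrightarrow>
     (\<forall>\<epsilon>>0. (\<lambda>n. outer_measure_of M {\<omega> \<in> space M. ennreal \<epsilon> < R n \<omega>}) \<longlonglongrightarrow> 0)"

text \<open>A simple integrand takes the value \<open>\<xi> j\<close> on \<open>{s j<..s (Suc j)}\<close>, for \<open>j < n\<close>.\<close>

definition simple_integrand ::
  "(real \<Rightarrow> 'a measure) \<Rightarrow> real \<Rightarrow> nat \<Rightarrow> (nat \<Rightarrow> real) \<Rightarrow> (nat \<Rightarrow> 'a \<Rightarrow> real^'d^'e) \<Rightarrow> bool" where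
  "simple_integrand F T n s \<xi> \<longleftrightarrow>
     (\<forall>j\<le>n. s j \<in> {0..T}) \<and> (\<forall>j<n. s j < s (Suc j)) \<and>
     (\<forall>j<n. \<xi> j \<in> borel_measurable (F (s j))) \<and>
     (\<exists>C. \<forall>j<n. \<forall>\<omega>\<in>space (F (s j)). norm (\<xi> j \<omega>) \<le> C)"

definition simple_process ::
  "nat \<Rightarrow> (nat \<Rightarrow> real) \<Rightarrow> (nat \<Rightarrow> 'a \<Rightarrow> real^'d^'e) \<Rightarrow> real \<Rightarrow> 'a \<Rightarrow> real^'d^'e" where
  "simple_process n s \<xi> r \<omega> = (\<Sum>j<n. indicator {s j<..s (Suc j)} r *\<^sub>R \<xi> j \<omega>)"

definition simple_ito ::
  "(real \<Rightarrow> 'a \<Rightarrow> real^'d) \<Rightarrow> nat \<Rightarrow> (nat \<Rightarrow> real) \<Rightarrow> (nat \<Rightarrow> 'a \<Rightarrow> real^'d^'e) \<Rightarrow> real \<Rightarrow> 'a \<Rightarrow> real^'e" where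
  "simple_ito W n s \<xi> t \<omega> =
     (\<Sum>j<n. \<xi> j \<omega> *v (W (min (s (Suc j)) t) \<omega> - W (min (s j) t) \<omega>))"

definition adapted :: "(real \<Rightarrow> 'a measure) \<Rightarrow> real \<Rightarrow> (real \<Rightarrow> 'a \<Rightarrow> 'b::topological_space) \<Rightarrow> bool" where
  "adapted F T H \<longleftrightarrow> (\<forall>t\<in>{0..T}. H t \<in> borel_measurable (F t))"

text \<open>\<open>J t\<close> is (the continuous version of) the Ito integral of \<open>H\<close> with respect to \<open>W\<close> over
  \<open>{0..t}\<close>.  That \<open>\<integral>|H|\<^sup>2 dr\<close> is almost surely finite follows from the approximation by simple
  integrands.\<close>

definition is_ito_integral ::
  "'a measure \<Rightarrow> (real \<Rightarrow> 'a measure) \<Rightarrow> (real \<Rightarrow> 'a \<Rightarrow> real^'d) \<Rightarrow> real \<Rightarrow>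
   (real \<Rightarrow> 'a \<Rightarrow> real^'d^'e) \<Rightarrow> (real \<Rightarrow> 'a \<Rightarrow> real^'e) \<Rightarrow> bool" where
  "is_ito_integral M F W T H J \<longleftrightarrow>
     adapted F T H \<and>
     (AE \<omega> in M. (\<lambda>r. H r \<omega>) \<in> borel_measurable (restrict_space borel {0..T})) \<and>
     adapted F T J \<and>
     (AE \<omega> in M. continuous_on {0..T} (\<lambda>t. J t \<omega>)) \<and>
     (\<exists>n s \<xi>. (\<forall>q. simple_integrand F T (n q) (s q) (\<xi> q)) \<and>
        tends_to_0_in_prob M (\<lambda>q \<omega>. \<integral>\<^sup>+ r \<in> {0..T}.
           ennreal ((norm (simple_process (n q) (s q) (\<xi> q) r \<omega> - H r \<omega>))\<^sup>2) \<partial>lborel) \<and>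
        (\<forall>t\<in>{0..T}. tends_to_0_in_prob M (\<lambda>q \<omega>.
           ennreal (norm (simple_ito W (n q) (s q) (\<xi> q) t \<omega> - J t \<omega>)))))"

definition sde_solution ::
  "'a measure \<Rightarrow> (real \<Rightarrow> 'a measure) \<Rightarrow> (real \<Rightarrow> 'a \<Rightarrow> real^'d) \<Rightarrow> real \<Rightarrow>
   (real \<Rightarrow> real^'e \<Rightarrow> real^'e) \<Rightarrow> (real \<Rightarrow> real^'e \<Rightarrow> real^'d^'e) \<Rightarrow> real^'e \<Rightarrow>
   (real \<Rightarrow> 'a \<Rightarrow> real^'e) \<Rightarrow> bool" where
  "sde_solution M F W T b \<sigma> x X \<longleftrightarrow>
     adapted F T X \<and>
     (AE \<omega> in M. continuous_on {0..T} (\<lambda>t. X t \<omega>)) \<and>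
     (\<exists>J. is_ito_integral M F W T (\<lambda>r \<omega>. \<sigma> r (X r \<omega>)) J \<and>
        (AE \<omega> in M. \<forall>t\<in>{0..T}. X t \<omega> = x + (LINT r:{0..t}|lborel. b r (X r \<omega>)) + J t \<omega>))"

section \<open>Assumptions on the coefficients\<close>

definition forward_lipschitz ::
  "real \<Rightarrow> (real \<Rightarrow> real^'d \<Rightarrow> real^'d) \<Rightarrow> (real \<Rightarrow> real^'d \<Rightarrow> real^'d^'d) \<Rightarrow> bool" where
  "forward_lipschitz T b \<sigma> \<longleftrightarrow>
     (\<exists>K. \<forall>t\<in>{0..T}. \<forall>t'\<in>{0..T}. \<forall>x x'.
        norm (b t x - b t' x) \<le> K * sqrt \<bar>t - t'\<bar> \<and>
        norm (\<sigma> t x - \<sigma> t' x) \<le> K * sqrt \<bar>t - t'\<bar> \<and>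
        norm (b t x - b t x') \<le> K * norm (x - x') \<and>
        norm (\<sigma> t x - \<sigma> t x') \<le> K * norm (x - x') \<and>
        norm (b t 0) \<le> K \<and>
        norm (\<sigma> t 0) \<le> K)"

definition monotone_growth ::
  "real \<Rightarrow> real \<Rightarrow> real \<Rightarrow> real \<Rightarrow> real \<Rightarrow> real \<Rightarrow> real \<Rightarrow>
   (real^'d \<Rightarrow> real^'k) \<Rightarrow> (real \<Rightarrow> real^'d \<Rightarrow> real^'k \<Rightarrow> real^'d^'k \<Rightarrow> real^'k) \<Rightarrow> bool" where
  "monotone_growth T m L L\<^sub>t L\<^sub>x L\<^sub>y L\<^sub>z g f \<longleftrightarrow>
     L > 0 \<and> L\<^sub>t > 0 \<and> L\<^sub>x > 0 \<and> L\<^sub>y > 0 \<and> L\<^sub>z > 0 \<and>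
     (\<exists>L\<^sub>g. L\<^sub>g-lipschitz_on UNIV g) \<and>
     continuous_on ({0..T} \<times> UNIV \<times> UNIV \<times> UNIV) (\<lambda>(t, x, y, z). f t x y z) \<and>
     (\<forall>t\<in>{0..T}. \<forall>x y z.
        norm (f t x y z) \<le> L + L\<^sub>x * norm x + L\<^sub>y * norm y powr m + L\<^sub>z * norm z) \<and>
     (\<forall>t\<in>{0..T}. \<forall>x y y' z.
        (y' - y) \<bullet> (f t x y' z - f t x y z) \<le> L\<^sub>y * (norm (y' - y))\<^sup>2) \<and>
     (\<forall>t\<in>{0..T}. \<forall>t'\<in>{0..T}. \<forall>x x' y z z'.
        norm (f t x y z - f t' x' y z')
          \<le> L\<^sub>t * sqrt \<bar>t - t'\<bar> + L\<^sub>x * norm (x - x') + L\<^sub>z * norm (z - z'))"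

section \<open>Discretisation\<close>

definition grid :: "real \<Rightarrow> nat \<Rightarrow> nat \<Rightarrow> real" where
  "grid T N i = real i * (T / real N)"

definition forward_approximation ::
  "'a measure \<Rightarrow> (real \<Rightarrow> 'a measure) \<Rightarrow> real \<Rightarrow> (real \<Rightarrow> 'a \<Rightarrow> real^'d) \<Rightarrow>
   (nat \<Rightarrow> nat \<Rightarrow> 'a \<Rightarrow> real^'d) \<Rightarrow> bool" where
  "forward_approximation M F T X Xh \<longleftrightarrow>
     (\<forall>N\<ge>1. \<forall>i\<le>N. Xh N i \<in> borel_measurable (F (grid T N i))) \<and>
     (\<exists>\<gamma>\<ge>1/2. \<forall>p\<ge>2. \<exists>c. \<forall>N\<ge>1. \<forall>i\<le>N.
        integrable M (\<lambda>\<omega>. norm (Xh N i \<omega>) powr p) \<and>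
        (LINT \<omega>|M. norm (Xh N i \<omega>) powr p) \<le> c \<and>
        integrable M (\<lambda>\<omega>. norm (X (grid T N i) \<omega> - Xh N i \<omega>) powr p) \<and>
        (LINT \<omega>|M. norm (X (grid T N i) \<omega> - Xh N i \<omega>) powr p) powr (1 / p)
          \<le> c * (T / real N) powr \<gamma>)"

text \<open>The library has the conditional expectation of real random variables only; for vectors and
  matrices it is taken coordinatewise.\<close>

definition vec_cond_exp ::
  "'a measure \<Rightarrow> 'a measure \<Rightarrow> ('a \<Rightarrow> 'b::euclidean_space) \<Rightarrow> 'a \<Rightarrow> 'b" where
  "vec_cond_exp M G A \<omega> = (\<Sum>u\<in>Basis. real_cond_exp M G (\<lambda>\<omega>'. A \<omega>' \<bullet> u) \<omega> *\<^sub>R u)"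

text \<open>The \<open>k \<times> d\<close> matrix \<open>A w\<^sup>*\<close>.\<close>

definition outer_prod :: "real^'k \<Rightarrow> real^'d \<Rightarrow> real^'d^'k" where
  "outer_prod A w = (\<chi> a j. A $ a * w $ j)"

text \<open>\<open>Y\<close> and \<open>Z\<close> are an output of the \<open>\<theta>\<close>-scheme with \<open>N\<close> steps, where \<open>Xh i\<close> approximates the
  forward process at time \<open>grid T N i\<close>.  Conditional expectations being defined up to null sets, the
  equations hold almost surely.\<close>

definition theta_scheme ::
  "'a measure \<Rightarrow> (real \<Rightarrow> 'a measure) \<Rightarrow> (real \<Rightarrow> 'a \<Rightarrow> real^'d) \<Rightarrow> real \<Rightarrow> real \<Rightarrow>
   (real^'d \<Rightarrow> real^'k) \<Rightarrow> (real \<Rightarrow> real^'d \<Rightarrow> real^'k \<Rightarrow> real^'d^'k \<Rightarrow> real^'k) \<Rightarrow>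
   nat \<Rightarrow> (nat \<Rightarrow> 'a \<Rightarrow> real^'d) \<Rightarrow> (nat \<Rightarrow> 'a \<Rightarrow> real^'k) \<Rightarrow> (nat \<Rightarrow> 'a \<Rightarrow> real^'d^'k) \<Rightarrow> bool" where
  "theta_scheme M F W T \<theta> g f N Xh Y Z \<longleftrightarrow>
     (let h = T / real N;
          \<tau> = grid T N;
          \<Delta>W = (\<lambda>i \<omega>. W (\<tau> (Suc i)) \<omega> - W (\<tau> i) \<omega>);
          \<phi> = (\<lambda>i \<omega>. f (\<tau> i) (Xh i \<omega>) (Y i \<omega>) (Z i \<omega>));
          A = (\<lambda>i \<omega>. Y (Suc i) \<omega> + ((1 - \<theta>) * h) *\<^sub>R \<phi> (Suc i) \<omega>)
      in (\<forall>i\<le>N. Y i \<in> borel_measurable (F (\<tau> i)) \<and> Z i \<in> borel_measurable (F (\<tau> i))) \<and>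
         (AE \<omega> in M. Y N \<omega> = g (Xh N \<omega>) \<and> Z N \<omega> = 0) \<and>
         (\<forall>i<N.
            (AE \<omega> in M. Z i \<omega> =
               vec_cond_exp M (F (\<tau> i)) (\<lambda>\<omega>'. (1 / h) *\<^sub>R outer_prod (A i \<omega>') (\<Delta>W i \<omega>')) \<omega>) \<and>
            (AE \<omega> in M. Y i \<omega> =
               vec_cond_exp M (F (\<tau> i)) (A i) \<omega> + (\<theta> * h) *\<^sub>R \<phi> i \<omega>)))"

end

theory Submission
  imports Defs
begin

text \<open>
  Write \<open>h\<close> for the step, \<open>\<phi>\<^sub>i\<close> for the driver evaluated along the output, and
  \<open>U\<^sub>i = Y\<^sub>i - \<theta> h \<phi>\<^sub>i\<close>.  The implicit equation for \<open>Y\<^sub>i\<close> says that \<open>U\<^sub>i\<close> is the conditional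
  expectation of \<open>A\<^sub>i = Y\<^sub>i\<^sub>+\<^sub>1 + (1 - \<theta>) h \<phi>\<^sub>i\<^sub>+\<^sub>1\<close>, and \<open>Z\<^sub>i\<close> collects the correlations of \<open>A\<^sub>i\<close> with the
  Brownian increment.  As the increment is centred, has variance \<open>h\<close> in each coordinate and is
  independent of the past, the conditional Bessel inequality (\<open>vec_cond_exp_bessel\<close>) gives
  \<open>|U\<^sub>i|\<^sup>2 + h |Z\<^sub>i|\<^sup>2 / d \<le> E\<^sub>i |A\<^sub>i|\<^sup>2\<close>.

  Before the terminal time the polynomially growing term \<open>|\<phi>|\<^sup>2\<close> never has to be estimated: since
  \<open>\<theta> \<ge> 1/2\<close>, passing from \<open>A\<^sub>i\<close> to \<open>U\<^sub>i\<^sub>+\<^sub>1\<close> only costs \<open>2 h (Y\<^sub>i\<^sub>+\<^sub>1 \<bullet> \<phi>\<^sub>i\<^sub>+\<^sub>1)\<close>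
  (\<open>explicit_part_norm_le\<close>), and monotonicity of the driver together with the restriction on \<open>h\<close>
  bounds this by \<open>C h |U|\<^sup>2 + C h (1 + |X|)\<^sup>2\<close> plus \<open>3/4\<close> of \<open>h |Z|\<^sup>2 / d\<close>, all at time \<open>i + 1\<close>
  (\<open>implicit_step_energy\<close>).  The factor \<open>3/4 < 1\<close> is
  what makes the argument close: the \<open>Z\<close>-term can be put into the energy
  \<open>V = |U|\<^sup>2 + 3/4 h |Z|\<^sup>2 / d\<close>, with a quarter of \<open>h |Z\<^sub>i|\<^sup>2 / d\<close> left over on the left-hand side
  (\<open>energy_step\<close>):
  \<open>V\<^sub>i + h |Z\<^sub>i|\<^sup>2 / (4 d) \<le> E\<^sub>i ((1 + C h) V\<^sub>i\<^sub>+\<^sub>1 + C h (1 + |X\<^sub>i\<^sub>+\<^sub>1|)\<^sup>2)\<close>.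

  Taking \<open>p\<close>-th powers preserves this structure: superadditivity of \<open>x \<mapsto> x\<^sup>p\<close> separates the two
  terms on the left, Jensen's inequality removes the conditional expectation, and convexity with
  weights of order \<open>h\<close> keeps the factor \<open>1 + O(h)\<close> on the right (\<open>energy_moment_step\<close>).  A backward
  discrete Gronwall argument then bounds all \<open>E V\<^sub>i\<^sup>p\<close> and the sum of the \<open>E (h |Z\<^sub>i|\<^sup>2)\<^sup>p\<close> by the
  terminal energy and the uniformly bounded moments of the forward approximation.  In the terminal
  energy the growth of the driver enters: \<open>Z\<^sub>N = 0\<close> and \<open>|U\<^sub>N| \<le> C (1 + |X\<^sub>N|)\<^sup>m\<close>,
  which produces the moment of order \<open>2 m p\<close>.  Finally \<open>|Y|\<^sup>2\<close> is controlled by \<open>V + (1 + |X|)\<^sup>2\<close>.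

  The conditional expectation of a non-integrable variable is a meaningless default value.  A
  preliminary backward induction (\<open>moments_YZ\<close>) therefore shows that \<open>Y\<^sub>i\<close> and \<open>Z\<^sub>i\<close> have finite
  moments of all orders; this class of random variables is closed under every operation that the
  scheme performs.
\<close>

section \<open>Random variables with finite moments of all orders\<close>

definition all_moments :: "'a measure \<Rightarrow> ('a \<Rightarrow> 'b::{banach,second_countable_topology}) \<Rightarrow> bool" where
  "all_moments M X \<longleftrightarrow> X \<in> borel_measurable M \<and> (\<forall>n. integrable M (\<lambda>\<omega>. norm (X \<omega>) ^ n))"

lemma all_moments_measurable [measurable_dest]: "all_moments M X \<Longrightarrow> X \<in> borel_measurable M"
  by (simp add: all_moments_def)

lemma all_moments_integrable: "all_moments M X \<Longrightarrow> integrable M X"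
  unfolding all_moments_def
  by (metis (no_types, lifting) integrable_norm_cancel power_one_right Bochner_Integration.integrable_cong)

lemma all_moments_bound:
  assumes "all_moments M Y" and [measurable]: "X \<in> borel_measurable M"
    and "AE \<omega> in M. norm (X \<omega>) \<le> norm (Y \<omega>)"
  shows "all_moments M X"
  unfolding all_moments_def
proof (intro conjI allI)
  fix n :: nat
  show "integrable M (\<lambda>\<omega>. norm (X \<omega>) ^ n)"
  proof (rule Bochner_Integration.integrable_bound)
    show "integrable M (\<lambda>\<omega>. norm (Y \<omega>) ^ n)"
      using assms(1) by (simp add: all_moments_def)
    show "AE \<omega> in M. norm (norm (X \<omega>) ^ n) \<le> norm (norm (Y \<omega>) ^ n)"
      using assms(3) by eventually_elim (simp add: power_mono)
  qed simp
qed simp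

lemma all_moments_norm:
  assumes "all_moments M X"
  shows "all_moments M (\<lambda>\<omega>. norm (X \<omega>))"
  using assms all_moments_measurable[OF assms] by (auto intro: all_moments_bound)

lemma all_moments_inner:
  fixes X :: "'a \<Rightarrow> 'b::euclidean_space"
  assumes "all_moments M X" "norm u = 1"
  shows "all_moments M (\<lambda>\<omega>. X \<omega> \<bullet> u)"
  using assms(1)
proof (rule all_moments_bound)
  show "AE \<omega> in M. norm (X \<omega> \<bullet> u) \<le> norm (X \<omega>)"
    using Cauchy_Schwarz_ineq2[of _ u] assms(2) by auto
  show "(\<lambda>\<omega>. X \<omega> \<bullet> u) \<in> borel_measurable M"
    using all_moments_measurable[OF assms(1)] by simp
qed

lemma (in finite_measure) all_moments_const: "all_moments M (\<lambda>_. c)"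
  by (simp add: all_moments_def)

lemma all_moments_add:
  assumes "all_moments M X" "all_moments M Y"
  shows "all_moments M (\<lambda>\<omega>. X \<omega> + Y \<omega>)"
  unfolding all_moments_def
proof (intro conjI allI)
  have [measurable]: "X \<in> borel_measurable M" "Y \<in> borel_measurable M"
    using assms by (auto simp: all_moments_def)
  show "(\<lambda>\<omega>. X \<omega> + Y \<omega>) \<in> borel_measurable M" by simp
  fix n :: nat
  show "integrable M (\<lambda>\<omega>. norm (X \<omega> + Y \<omega>) ^ n)"
  proof (rule Bochner_Integration.integrable_bound)
    show "integrable M (\<lambda>\<omega>. 2 ^ n * (norm (X \<omega>) ^ n + norm (Y \<omega>) ^ n))"
      using assms by (simp add: all_moments_def)
    have "norm (x + y) ^ n \<le> 2 ^ n * (norm x ^ n + norm y ^ n)" for x y :: 'b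
    proof -
      have "norm (x + y) ^ n \<le> (2 * max (norm x) (norm y)) ^ n"
        using norm_triangle_ineq[of x y] by (intro power_mono) auto
      also have "\<dots> \<le> 2 ^ n * (norm x ^ n + norm y ^ n)"
        by (auto simp: power_mult_distrib max_def)
      finally show ?thesis .
    qed
    then show "AE \<omega> in M. norm (norm (X \<omega> + Y \<omega>) ^ n)
        \<le> norm (2 ^ n * (norm (X \<omega>) ^ n + norm (Y \<omega>) ^ n))"
      by (simp add: abs_mult)
  qed simp
qed

lemma all_moments_mult:
  fixes X Y :: "'a \<Rightarrow> real"
  assumes "all_moments M X" "all_moments M Y"
  shows "all_moments M (\<lambda>\<omega>. X \<omega> * Y \<omega>)"
  unfolding all_moments_def
proof (intro conjI allI)
  have [measurable]: "X \<in> borel_measurable M" "Y \<in> borel_measurable M"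
    using assms by (auto simp: all_moments_def)
  show "(\<lambda>\<omega>. X \<omega> * Y \<omega>) \<in> borel_measurable M" by simp
  fix n :: nat
  show "integrable M (\<lambda>\<omega>. norm (X \<omega> * Y \<omega>) ^ n)"
  proof (rule Bochner_Integration.integrable_bound)
    show "integrable M (\<lambda>\<omega>. norm (X \<omega>) ^ (2 * n) + norm (Y \<omega>) ^ (2 * n))"
      using assms by (intro Bochner_Integration.integrable_add) (simp_all add: all_moments_def)
    have "\<bar>x * y\<bar> ^ n \<le> \<bar>x\<bar> ^ (2 * n) + \<bar>y\<bar> ^ (2 * n)" for x y :: real
    proof -
      have "\<bar>x * y\<bar> ^ n \<le> (max \<bar>x\<bar> \<bar>y\<bar> * max \<bar>x\<bar> \<bar>y\<bar>) ^ n"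
        unfolding abs_mult by (intro power_mono mult_mono) auto
      also have "\<dots> = max \<bar>x\<bar> \<bar>y\<bar> ^ (2 * n)"
        by (simp add: power2_eq_square power_mult)
      also have "\<dots> \<le> \<bar>x\<bar> ^ (2 * n) + \<bar>y\<bar> ^ (2 * n)"
        by (auto simp: max_def)
      finally show ?thesis .
    qed
    then show "AE \<omega> in M. norm (norm (X \<omega> * Y \<omega>) ^ n)
        \<le> norm (norm (X \<omega>) ^ (2 * n) + norm (Y \<omega>) ^ (2 * n))"
      by simp
  qed simp
qed

lemma (in finite_measure) all_moments_scaleR:
  assumes "all_moments M X"
  shows "all_moments M (\<lambda>\<omega>. c *\<^sub>R X \<omega>)"
proof (rule all_moments_bound)
  show "all_moments M (\<lambda>\<omega>. \<bar>c\<bar> * norm (X \<omega>))"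
    by (intro all_moments_mult all_moments_const all_moments_norm assms)
  show "(\<lambda>\<omega>. c *\<^sub>R X \<omega>) \<in> borel_measurable M"
    using all_moments_measurable[OF assms] by simp
qed simp

lemma (in finite_measure) all_moments_scaleR_left:
  fixes X :: "'a \<Rightarrow> real"
  assumes "all_moments M X"
  shows "all_moments M (\<lambda>\<omega>. X \<omega> *\<^sub>R v)"
proof (rule all_moments_bound)
  show "all_moments M (\<lambda>\<omega>. norm v * norm (X \<omega>))"
    by (intro all_moments_mult all_moments_const all_moments_norm assms)
  show "(\<lambda>\<omega>. X \<omega> *\<^sub>R v) \<in> borel_measurable M"
    using all_moments_measurable[OF assms] by simp
qed (simp add: mult.commute)

lemma (in finite_measure) all_moments_sum:
  assumes "\<And>i. i \<in> I \<Longrightarrow> all_moments M (X i)"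
  shows "all_moments M (\<lambda>\<omega>. \<Sum>i\<in>I. X i \<omega>)"
  using assms
proof (induction I rule: infinite_finite_induct)
  case (insert i I)
  then show ?case using all_moments_add[of M "X i" "\<lambda>\<omega>. \<Sum>i\<in>I. X i \<omega>"] by simp
qed (simp_all add: all_moments_const)

lemma (in finite_measure) all_moments_diff:
  assumes "all_moments M X" "all_moments M Y"
  shows "all_moments M (\<lambda>\<omega>. X \<omega> - Y \<omega>)"
  using all_moments_add[OF assms(1) all_moments_scaleR[OF assms(2), of "-1"]] by simp

lemma (in finite_measure) all_moments_powr:
  assumes "all_moments M X" "q \<ge> 0"
  shows "all_moments M (\<lambda>\<omega>. norm (X \<omega>) powr q)"
proof -
  define k where "k = nat \<lceil>q\<rceil>"
  have k: "q \<le> real k" using assms(2) by (simp add: k_def)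
  have [measurable]: "X \<in> borel_measurable M" using assms by (auto simp: all_moments_def)
  have "all_moments M (\<lambda>\<omega>. norm (X \<omega>) ^ n)" for n
    by (induction n) (simp_all add: all_moments_const all_moments_mult all_moments_norm assms)
  then have "all_moments M (\<lambda>\<omega>. 1 + norm (X \<omega>) ^ k)"
    by (intro all_moments_add all_moments_const)
  then show ?thesis
  proof (rule all_moments_bound)
    have "r powr q \<le> 1 + r ^ k" if "r \<ge> 0" for r :: real
    proof (cases "r \<le> 1")
      case True
      then have "r powr q \<le> 1" using that assms(2) by (simp add: powr_le1)
      then show ?thesis using that by (simp add: add_increasing2)
    next
      case False
      then have "r powr q \<le> r powr real k" using k by (intro powr_mono) auto
      also have "\<dots> = r ^ k" using False by (simp add: powr_realpow)
      finally show ?thesis by simp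
    qed
    then show "AE \<omega> in M. norm (norm (X \<omega>) powr q) \<le> norm (1 + norm (X \<omega>) ^ k)"
      by simp
  qed simp
qed

lemma (in finite_measure) all_moments_powr_nonneg:
  fixes X :: "'a \<Rightarrow> real"
  assumes "all_moments M X" "\<And>\<omega>. 0 \<le> X \<omega>" "0 \<le> q"
  shows "all_moments M (\<lambda>\<omega>. X \<omega> powr q)"
  using all_moments_powr[OF assms(1,3)] assms(2) by simp

text \<open>Conditional Jensen for the even power \<open>2 n\<close>, which is convex and smooth on the whole line, also
  controls the power \<open>n\<close>.\<close>

lemma (in finite_measure_subalgebra) all_moments_real_cond_exp:
  assumes "all_moments M X"
  shows "all_moments M (real_cond_exp M F X)"
  unfolding all_moments_def
proof (intro conjI allI)
  show [measurable]: "real_cond_exp M F X \<in> borel_measurable M" by simp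
  fix n :: nat
  have int: "integrable M (\<lambda>\<omega>. (X \<omega>) ^ (2 * n))"
  proof -
    have "integrable M (\<lambda>\<omega>. norm (X \<omega>) ^ (2 * n))"
      using assms by (simp add: all_moments_def)
    then show ?thesis by (simp add: power_even_abs)
  qed
  have "integrable M (\<lambda>\<omega>. (real_cond_exp M F X \<omega>) ^ (2 * n))"
    by (rule integrable_convex_cond_exp[where I = UNIV])
      (use assms int in \<open>auto intro: all_moments_integrable convex_power_even\<close>)
  then have i: "integrable M (\<lambda>\<omega>. 1 + (real_cond_exp M F X \<omega>) ^ (2 * n))" by simp
  have "\<bar>r\<bar> ^ n \<le> 1 + r ^ (2 * n)" for r :: real
  proof -
    have "a \<le> 1 + a\<^sup>2" if "a \<ge> 0" for a :: real
      using zero_le_power2[of "a - 1"] that by (simp add: power2_diff)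
    from this[of "\<bar>r\<bar> ^ n"] show ?thesis
      by (simp add: power_even_abs flip: power_mult mult.commute)
  qed
  then show "integrable M (\<lambda>\<omega>. norm (real_cond_exp M F X \<omega>) ^ n)"
    by (intro Bochner_Integration.integrable_bound[OF i]) auto
qed

lemma (in finite_measure_subalgebra) all_moments_vec_cond_exp:
  assumes "all_moments M X"
  shows "all_moments M (vec_cond_exp M F X)"
proof -
  have "all_moments M (\<lambda>\<omega>. \<Sum>u\<in>Basis. real_cond_exp M F (\<lambda>\<omega>'. X \<omega>' \<bullet> u) \<omega> *\<^sub>R u)"
    by (intro all_moments_sum all_moments_scaleR_left all_moments_real_cond_exp
        all_moments_inner assms) auto
  then show ?thesis by (simp add: vec_cond_exp_def[abs_def])
qed

text \<open>The absolute value extends the power function convexly to an open interval containing \<open>0\<close>, as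
  the conditional Jensen inequality demands; at the origin, where the second derivative does not
  decide convexity, \<open>s powr p \<le> s\<close> for \<open>s \<le> 1\<close> suffices.\<close>

lemma convex_on_abs_powr:
  assumes "p \<ge> 1"
  shows "convex_on UNIV (\<lambda>x::real. \<bar>x\<bar> powr p)"
proof (rule convex_onI)
  fix t x y :: real
  assume t: "0 < t" "t < 1"
  have shrink: "(s * a) powr p \<le> s * a powr p" if "0 \<le> s" "s \<le> 1" "0 \<le> a" for s a :: real
  proof -
    have "s powr p \<le> s powr 1"
      using that assms powr_mono'[of 1 p s] by (cases "s = 0") auto
    then show ?thesis using that by (simp add: powr_mult mult_right_mono)
  qed
  have "\<bar>(1 - t) *\<^sub>R x + t *\<^sub>R y\<bar> powr p \<le> ((1 - t) * \<bar>x\<bar> + t * \<bar>y\<bar>) powr p"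
    using t assms abs_triangle_ineq[of "(1 - t) * x" "t * y"]
    by (intro powr_mono2) (auto simp: abs_mult)
  also have "\<dots> \<le> (1 - t) * \<bar>x\<bar> powr p + t * \<bar>y\<bar> powr p"
  proof (cases "x = 0 \<or> y = 0")
    case True
    then show ?thesis
      using shrink[of t "\<bar>y\<bar>"] shrink[of "1 - t" "\<bar>x\<bar>"] t assms by auto
  next
    case False
    then show ?thesis
      using convex_onD[OF powr_convex[OF assms], of t "\<bar>x\<bar>" "\<bar>y\<bar>"] t by auto
  qed
  finally show "\<bar>(1 - t) *\<^sub>R x + t *\<^sub>R y\<bar> powr p \<le> (1 - t) * \<bar>x\<bar> powr p + t * \<bar>y\<bar> powr p" .
qed simp

lemma (in finite_measure_subalgebra) integral_powr_le_of_le_cond_exp: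
  assumes "p \<ge> 1" and R: "integrable M R" "integrable M (\<lambda>\<omega>. \<bar>R \<omega>\<bar> powr p)"
    and [measurable]: "S \<in> borel_measurable M"
    and "AE \<omega> in M. 0 \<le> S \<omega>" "AE \<omega> in M. S \<omega> \<le> real_cond_exp M F R \<omega>"
  shows "(LINT \<omega>|M. S \<omega> powr p) \<le> (LINT \<omega>|M. \<bar>R \<omega>\<bar> powr p)"
proof -
  have "AE \<omega> in M. \<bar>real_cond_exp M F R \<omega>\<bar> powr p \<le> real_cond_exp M F (\<lambda>\<omega>. \<bar>R \<omega>\<bar> powr p) \<omega>"
    by (rule real_cond_exp_jensens_inequality(2)[where I = UNIV and q = "\<lambda>x. \<bar>x\<bar> powr p"])
      (use assms in \<open>auto intro: convex_on_abs_powr\<close>)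
  with assms(5,6) have "AE \<omega> in M. S \<omega> powr p \<le> real_cond_exp M F (\<lambda>\<omega>. \<bar>R \<omega>\<bar> powr p) \<omega>"
  proof eventually_elim
    case (elim \<omega>)
    then have "S \<omega> powr p \<le> \<bar>real_cond_exp M F R \<omega>\<bar> powr p"
      using assms(1) by (intro powr_mono2) auto
    with elim show ?case by simp
  qed
  then have "(LINT \<omega>|M. S \<omega> powr p) \<le> (LINT \<omega>|M. real_cond_exp M F (\<lambda>\<omega>. \<bar>R \<omega>\<bar> powr p) \<omega>)"
    by (intro integral_mono_AE' real_cond_exp_int R real_cond_exp_pos borel_measurable_integrable) (auto simp: R)
  then show ?thesis using real_cond_exp_int(2)[OF R(2)] by simp
qed

section \<open>Independence of Brownian increments from the past\<close>

lemma subalgebra_aug_filtration: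
  assumes "\<And>s. s \<in> {0..t} \<Longrightarrow> W s \<in> borel_measurable M"
  shows "subalgebra M (aug_filtration M W t)"
proof -
  have "{W s -` B \<inter> space M | s B. s \<in> {0..t} \<and> B \<in> sets borel} \<union> null_sets M \<subseteq> sets M"
    using assms by (auto intro: measurable_sets)
  moreover from this have "{W s -` B \<inter> space M | s B. s \<in> {0..t} \<and> B \<in> sets borel} \<union> null_sets M
      \<subseteq> Pow (space M)"
    using sets.space_closed by (rule subset_trans)
  ultimately show ?thesis
    unfolding subalgebra_def aug_filtration_def
    by (simp only: sets_measure_of space_measure_of sets.sigma_sets_subset)
qed

text \<open>Refine the finitely many observation times in \<open>J\<close> to a partition of \<open>{0..t}\<close> that ends with
  the step from \<open>s\<close> to \<open>t\<close>.  As \<open>W 0 = 0\<close> almost surely, the observed values are partial sums of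
  the earlier increments, which are independent of the last one.\<close>

lemma (in prob_space) indep_increment_past_values:
  fixes W :: "real \<Rightarrow> 'a \<Rightarrow> real^'d"
  assumes bm: "brownian_motion M T W"
    and st: "0 \<le> s" "s \<le> t" "t \<le> T"
    and J: "finite J" "J \<subseteq> {0..s}"
    and B: "\<And>r. r \<in> J \<Longrightarrow> B r \<in> sets borel" and C: "C \<in> sets borel"
  shows "prob ({\<omega>\<in>space M. (\<forall>r\<in>J. W r \<omega> \<in> B r) \<and> W t \<omega> - W s \<omega> \<in> C}) =
    prob {\<omega>\<in>space M. \<forall>r\<in>J. W r \<omega> \<in> B r} * prob {\<omega>\<in>space M. W t \<omega> - W s \<omega> \<in> C}"
proof -
  have W: "W r \<in> borel_measurable M" if "r \<in> {0..T}" for r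
    using bm that by (simp add: brownian_motion_def)
  have W0: "AE \<omega> in M. W 0 \<omega> = 0"
    using bm by (simp add: brownian_motion_def)
  \<comment> \<open>\<open>u 0 = 0, ..., u n = s\<close> lists the observation times in order, and \<open>u (Suc n) = t\<close>.\<close>
  define xs where "xs = sorted_list_of_set (insert 0 (insert s J))"
  define n where "n = length xs - 1"
  have set_xs: "set xs = insert 0 (insert s J)" and sorted: "sorted xs" and xs: "xs \<noteq> []"
    using J unfolding xs_def by (simp_all del: sorted_list_of_set_insert_remove)
  have len: "length xs = Suc n" using xs by (simp add: n_def)
  define u where "u i = (if i \<le> n then xs ! i else t)" for i
  have u_in: "u i \<in> {0..s}" if "i \<le> n" for i
    using that J st nth_mem[of i xs] len unfolding u_def set_xs by auto
  have mono: "u i \<le> u j" if "i \<le> j" "j \<le> n" for i j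
    using that sorted len by (simp add: u_def sorted_nth_mono)
  have ex: "\<exists>i\<le>n. u i = r" if "r \<in> insert 0 (insert s J)" for r
    using that len unfolding set_xs[symmetric] in_set_conv_nth u_def by (metis less_Suc_eq_le)
  have u0: "u 0 = 0"
    using ex[of 0] mono[of 0] u_in[of 0] by fastforce
  have un: "u n = s"
    using ex[of s] mono[of _ n] u_in[of n] by fastforce
  have uSn: "u (Suc n) = t" by (simp add: u_def)
  define D where "D i \<omega> = W (u (Suc i)) \<omega> - W (u i) \<omega>" for i \<omega>
  have "\<forall>i\<le>Suc n. u i \<in> {0..T}"
    using u_in st uSn by (metis (no_types, opaque_lifting) atLeastAtMost_iff le_SucE order_trans)
  moreover have "\<forall>i<Suc n. u i \<le> u (Suc i)"
    using mono un uSn st by (metis Suc_leI le_SucI less_Suc_eq order_refl)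
  ultimately have ind: "indep_vars (\<lambda>_. borel) D {..<Suc n}"
    using bm unfolding brownian_motion_def D_def by blast
  have iv: "indep_var (PiM {..<n} (\<lambda>_. borel)) (\<lambda>\<omega>. restrict (\<lambda>i. D i \<omega>) {..<n})
      (PiM {n} (\<lambda>_. borel)) (\<lambda>\<omega>. restrict (\<lambda>i. D i \<omega>) {n})"
    by (rule indep_var_restrict[OF ind]) auto
  define idx where "idx r = (SOME i. i \<le> n \<and> u i = r)" for r
  have idx: "idx r \<le> n" "u (idx r) = r" if "r \<in> J" for r
    using someI_ex[of "\<lambda>i. i \<le> n \<and> u i = r"] ex[of r] that by (auto simp: idx_def)
  have tele: "(\<Sum>i<k. D i \<omega>) = W (u k) \<omega> - W (u 0) \<omega>" for k \<omega>
    unfolding D_def by (rule sum_lessThan_telescope)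
  define E where "E = {d \<in> space (PiM {..<n} (\<lambda>_. borel :: (real^'d) measure)). \<forall>r\<in>J. (\<Sum>i<idx r. d i) \<in> B r}"
  define E' where "E' = {d \<in> space (PiM {n} (\<lambda>_. borel :: (real^'d) measure)). d n \<in> C}"
  have m: "(\<lambda>d. \<Sum>i<idx r. d i) \<in> borel_measurable (PiM {..<n} (\<lambda>_. borel :: (real^'d) measure))"
    if "r \<in> J" for r
    using idx[OF that] by (intro borel_measurable_sum measurable_component_singleton) auto
  have E: "E \<in> sets (PiM {..<n} (\<lambda>_. borel))"
  proof (cases "J = {}")
    case True
    then have "E = space (PiM {..<n} (\<lambda>_. borel))" unfolding E_def by blast
    then show ?thesis by (simp only: sets.top)
  next
    case False
    then have "E = (\<Inter>r\<in>J. (\<lambda>d. \<Sum>i<idx r. d i) -` B r \<inter> space (PiM {..<n} (\<lambda>_. borel)))"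
      unfolding E_def by blast
    then show ?thesis
      by (simp only:) (rule sets.finite_INT[OF J(1) False measurable_sets[OF m B]])
  qed
  have E': "E' \<in> sets (PiM {n} (\<lambda>_. borel))"
  proof -
    have "E' = (\<lambda>d. d n) -` C \<inter> space (PiM {n} (\<lambda>_. borel))" unfolding E'_def by blast
    moreover have "(\<lambda>d. d n) \<in> borel_measurable (PiM {n} (\<lambda>_. borel :: (real^'d) measure))"
      by (rule measurable_component_singleton) simp
    ultimately show ?thesis using measurable_sets[OF _ C] by metis
  qed
  have past: "(\<lambda>\<omega>. restrict (\<lambda>i. D i \<omega>) {..<n}) -` E \<inter> space M =
      {\<omega>\<in>space M. \<forall>r\<in>J. W r \<omega> - W 0 \<omega> \<in> B r}"
  proof -
    have "(\<Sum>i<idx r. restrict (\<lambda>i. D i \<omega>) {..<n} i) = W r \<omega> - W 0 \<omega>" if "r \<in> J" for r \<omega>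
    proof -
      have "(\<Sum>i<idx r. restrict (\<lambda>i. D i \<omega>) {..<n} i) = (\<Sum>i<idx r. D i \<omega>)"
        using idx[OF that] by (intro sum.cong) auto
      then show ?thesis using idx[OF that] u0 by (simp add: tele)
    qed
    then show ?thesis by (auto simp: E_def space_PiM)
  qed
  have future: "(\<lambda>\<omega>. restrict (\<lambda>i. D i \<omega>) {n}) -` E' \<inter> space M = {\<omega>\<in>space M. W t \<omega> - W s \<omega> \<in> C}"
    by (auto simp: E'_def D_def un uSn space_PiM)
  have [measurable]: "W t \<in> borel_measurable M" "W s \<in> borel_measurable M" "W 0 \<in> borel_measurable M"
    using W st by auto
  have W_J: "W r \<in> borel_measurable M" if "r \<in> J" for r
    using W J st that by auto
  have [measurable]: "{\<omega>\<in>space M. \<forall>r\<in>J. W r \<omega> - W 0 \<omega> \<in> B r} \<in> events"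
    using J(1) B W_J by (auto intro!: sets.sets_Collect_finite_All simp: pred_def[symmetric])
  have [measurable]: "{\<omega>\<in>space M. \<forall>r\<in>J. W r \<omega> \<in> B r} \<in> events"
    using J(1) B W_J by (auto intro!: sets.sets_Collect_finite_All simp: pred_def[symmetric])
  have [measurable]: "{\<omega>\<in>space M. W t \<omega> - W s \<omega> \<in> C} \<in> events" using C by measurable
  have "prob {\<omega>\<in>space M. (\<forall>r\<in>J. W r \<omega> \<in> B r) \<and> W t \<omega> - W s \<omega> \<in> C} =
      prob ({\<omega>\<in>space M. \<forall>r\<in>J. W r \<omega> - W 0 \<omega> \<in> B r} \<inter> {\<omega>\<in>space M. W t \<omega> - W s \<omega> \<in> C})"
  proof (rule measure_eq_AE)
    show "AE \<omega> in M. \<omega> \<in> {\<omega>\<in>space M. (\<forall>r\<in>J. W r \<omega> \<in> B r) \<and> W t \<omega> - W s \<omega> \<in> C} \<longleftrightarrow>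
      \<omega> \<in> {\<omega>\<in>space M. \<forall>r\<in>J. W r \<omega> - W 0 \<omega> \<in> B r} \<inter> {\<omega>\<in>space M. W t \<omega> - W s \<omega> \<in> C}"
      using W0 by eventually_elim auto
    have "{\<omega>\<in>space M. \<forall>r\<in>J. W r \<omega> \<in> B r} \<inter> {\<omega>\<in>space M. W t \<omega> - W s \<omega> \<in> C} \<in> events" by measurable
    also have "{\<omega>\<in>space M. \<forall>r\<in>J. W r \<omega> \<in> B r} \<inter> {\<omega>\<in>space M. W t \<omega> - W s \<omega> \<in> C} =
      {\<omega>\<in>space M. (\<forall>r\<in>J. W r \<omega> \<in> B r) \<and> W t \<omega> - W s \<omega> \<in> C}" by auto
    finally show "{\<omega>\<in>space M. (\<forall>r\<in>J. W r \<omega> \<in> B r) \<and> W t \<omega> - W s \<omega> \<in> C} \<in> events" .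
  qed measurable
  also have "\<dots> = prob {\<omega>\<in>space M. \<forall>r\<in>J. W r \<omega> - W 0 \<omega> \<in> B r} * prob {\<omega>\<in>space M. W t \<omega> - W s \<omega> \<in> C}"
    using indep_varD[OF iv E E'] unfolding past future
    by (simp add: past[symmetric] future[symmetric] Int_def vimage_def conj_ac cong: conj_cong)
  also have "prob {\<omega>\<in>space M. \<forall>r\<in>J. W r \<omega> - W 0 \<omega> \<in> B r} = prob {\<omega>\<in>space M. \<forall>r\<in>J. W r \<omega> \<in> B r}"
    by (rule measure_eq_AE) (use W0 in \<open>eventually_elim, auto\<close>, measurable)
  finally show ?thesis .
qed

text \<open>A \<open>\<pi>\<close>-\<open>\<lambda>\<close> argument.  Events that agree almost surely with a finite-dimensional cylinder form a
  \<open>\<pi>\<close>-system, and it contains both kinds of generators of the augmented filtration: a null set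
  agrees with the empty cylinder.\<close>

lemma (in prob_space) indep_increment_aug_filtration:
  fixes W :: "real \<Rightarrow> 'a \<Rightarrow> real^'d"
  assumes bm: "brownian_motion M T W"
    and st: "0 \<le> s" "s \<le> t" "t \<le> T"
    and A: "A \<in> sets (aug_filtration M W s)" and C: "C \<in> sets borel"
  shows "prob (A \<inter> {\<omega>\<in>space M. W t \<omega> - W s \<omega> \<in> C}) =
    prob A * prob {\<omega>\<in>space M. W t \<omega> - W s \<omega> \<in> C}"
proof -
  have W: "W r \<in> borel_measurable M" if "r \<in> {0..T}" for r
    using bm that by (simp add: brownian_motion_def)
  have [measurable]: "W t \<in> borel_measurable M" "W s \<in> borel_measurable M" using W st by auto
  define cyl where "cyl J B = {\<omega>\<in>space M. \<forall>r\<in>J. W r \<omega> \<in> B r}" for J and B :: "real \<Rightarrow> (real^'d) set"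
  have cyl_ev: "cyl J B \<in> events" if "finite J" "J \<subseteq> {0..s}" "\<And>r. B r \<in> sets borel" for J B
  proof -
    have "W r \<in> borel_measurable M" if "r \<in> J" for r
      using W \<open>J \<subseteq> {0..s}\<close> st that by auto
    then show ?thesis
      using that unfolding cyl_def
      by (auto intro!: sets.sets_Collect_finite_All simp: pred_def[symmetric])
  qed
  define P where "P = {A \<in> events. \<exists>J B. finite J \<and> J \<subseteq> {0..s} \<and> (\<forall>r. B r \<in> sets borel) \<and>
    (AE \<omega> in M. \<omega> \<in> A \<longleftrightarrow> \<omega> \<in> cyl J B)}"
  define Q where "Q = {{\<omega>\<in>space M. W t \<omega> - W s \<omega> \<in> C} | C. C \<in> sets borel}"
  have "indep_set P Q"
  proof (rule indep_setI)
    show "P \<subseteq> events" by (auto simp: P_def)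
    show "Q \<subseteq> events" by (auto simp: Q_def)
    fix a b assume "a \<in> P" "b \<in> Q"
    then obtain J B C where J: "finite J" "J \<subseteq> {0..s}" "\<And>r. B r \<in> sets borel"
      and ae: "AE \<omega> in M. \<omega> \<in> a \<longleftrightarrow> \<omega> \<in> cyl J B" and a: "a \<in> events"
      and C: "C \<in> sets borel" and b: "b = {\<omega>\<in>space M. W t \<omega> - W s \<omega> \<in> C}"
      by (auto simp: P_def Q_def)
    have b_ev: "b \<in> events" unfolding b using C by measurable
    have "prob (a \<inter> b) = prob (cyl J B \<inter> b)"
      using ae by (intro measure_eq_AE) (auto simp: a b_ev cyl_ev J)
    also have "cyl J B \<inter> b = {\<omega>\<in>space M. (\<forall>r\<in>J. W r \<omega> \<in> B r) \<and> W t \<omega> - W s \<omega> \<in> C}"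
      by (auto simp: b cyl_def)
    also have "prob \<dots> = prob (cyl J B) * prob b"
      unfolding b cyl_def by (rule indep_increment_past_values[OF bm st J(1,2) J(3) C])
    also have "prob (cyl J B) = prob a"
      using ae by (intro measure_eq_AE) (auto simp: a cyl_ev J)
    finally show "prob (a \<inter> b) = prob a * prob b" .
  qed
  moreover have "Int_stable P"
  proof (rule Int_stableI)
    fix a b assume "a \<in> P" "b \<in> P"
    then obtain J B J' B' where J: "finite J" "J \<subseteq> {0..s}" "\<forall>r. B r \<in> sets borel"
      and J': "finite J'" "J' \<subseteq> {0..s}" "\<forall>r. B' r \<in> sets borel"
      and ae: "AE \<omega> in M. \<omega> \<in> a \<longleftrightarrow> \<omega> \<in> cyl J B" "AE \<omega> in M. \<omega> \<in> b \<longleftrightarrow> \<omega> \<in> cyl J' B'"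
      and ev: "a \<in> events" "b \<in> events"
      unfolding P_def by blast
    define B'' where "B'' r = (if r \<in> J then B r else UNIV) \<inter> (if r \<in> J' then B' r else UNIV)" for r
    have "cyl (J \<union> J') B'' = cyl J B \<inter> cyl J' B'"
      by (auto simp: cyl_def B''_def)
    moreover from ae have "AE \<omega> in M. \<omega> \<in> a \<inter> b \<longleftrightarrow> \<omega> \<in> cyl J B \<inter> cyl J' B'"
      by eventually_elim auto
    moreover have "\<forall>r. B'' r \<in> sets borel" using J J' by (auto simp: B''_def)
    ultimately show "a \<inter> b \<in> P"
      using J J' ev unfolding P_def
      by (auto intro!: exI[of _ "J \<union> J'"] exI[of _ B''])
  qed
  moreover have "Int_stable Q"
  proof (rule Int_stableI)
    fix a b assume "a \<in> Q" "b \<in> Q"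
    then obtain C C' where "C \<in> sets borel" "C' \<in> sets borel"
      "a = {\<omega>\<in>space M. W t \<omega> - W s \<omega> \<in> C}" "b = {\<omega>\<in>space M. W t \<omega> - W s \<omega> \<in> C'}"
      by (auto simp: Q_def)
    then show "a \<inter> b \<in> Q" unfolding Q_def by (auto intro!: exI[of _ "C \<inter> C'"])
  qed
  ultimately have "indep_set (sigma_sets (space M) P) (sigma_sets (space M) Q)"
    by (rule indep_set_sigma_sets)
  moreover have "A \<in> sigma_sets (space M) P"
  proof -
    have gen: "{W r -` B \<inter> space M | r B. r \<in> {0..s} \<and> B \<in> sets borel} \<union> null_sets M \<subseteq> P"
    proof (intro Un_least subsetI)
      fix a assume "a \<in> {W r -` B \<inter> space M | r B. r \<in> {0..s} \<and> B \<in> sets borel}"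
      then obtain r B where r: "r \<in> {0..s}" "B \<in> sets borel" "a = W r -` B \<inter> space M" by auto
      then have "a = cyl {r} (\<lambda>_. B)" by (auto simp: cyl_def)
      then show "a \<in> P"
        unfolding P_def using r cyl_ev[of "{r}" "\<lambda>_. B"]
        by (auto intro!: exI[of _ "{r}"] exI[of _ "\<lambda>_. B"])
    next
      fix a assume a: "a \<in> null_sets M"
      have "AE \<omega> in M. \<omega> \<in> a \<longleftrightarrow> \<omega> \<in> cyl {0} (\<lambda>_. {})"
        using AE_not_in[OF a] by eventually_elim (auto simp: cyl_def)
      then show "a \<in> P"
        unfolding P_def using a st by (auto intro!: exI[of _ "{0}"] exI[of _ "\<lambda>_. {}"])
    qed
    have "{W r -` B \<inter> space M | r B. r \<in> {0..s} \<and> B \<in> sets borel} \<union> null_sets M \<subseteq> Pow (space M)"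
      using sets.sets_into_space by auto
    then have "A \<in> sigma_sets (space M)
        ({W r -` B \<inter> space M | r B. r \<in> {0..s} \<and> B \<in> sets borel} \<union> null_sets M)"
      using A unfolding aug_filtration_def by (simp add: sets_measure_of)
    then show ?thesis using sigma_sets_mono'[OF gen] by auto
  qed
  moreover have "{\<omega>\<in>space M. W t \<omega> - W s \<omega> \<in> C} \<in> sigma_sets (space M) Q"
    using C by (auto simp: Q_def)
  ultimately show ?thesis by (rule indep_setD)
qed

lemma (in prob_space) cond_exp_indep_const:
  fixes X :: "'a \<Rightarrow> real"
  assumes F: "subalgebra M F" and X: "integrable M X"
    and ind: "\<And>A C. A \<in> sets F \<Longrightarrow> C \<in> sets borel \<Longrightarrow>
      prob (A \<inter> (X -` C \<inter> space M)) = prob A * prob (X -` C \<inter> space M)"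
  shows "AE \<omega> in M. real_cond_exp M F X \<omega> = expectation X"
proof -
  interpret finite_measure_subalgebra M F
    by unfold_locales (rule F)
  show ?thesis
  proof (rule real_cond_exp_charact)
    fix A assume A: "A \<in> sets F"
    have A_ev: "A \<in> events" using A F by (auto simp: subalgebra_def)
    have [measurable]: "X \<in> borel_measurable M" using X by simp
    have iA: "indicator A \<in> borel_measurable M" using A_ev by simp
    have "indep_var borel (indicator A :: 'a \<Rightarrow> real) borel X"
      unfolding indep_var_eq
    proof (intro conjI indep_set_sigma_sets indep_setI)
      show "random_variable borel (indicator A :: 'a \<Rightarrow> real)" "random_variable borel X"
        using iA by auto
      show "{(indicator A :: 'a \<Rightarrow> real) -` B \<inter> space M |B. B \<in> sets borel} \<subseteq> events"
        using measurable_sets[OF iA] by auto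
      show "{X -` B \<inter> space M |B. B \<in> sets borel} \<subseteq> events" by auto
      have stable: "Int_stable {h -` B \<inter> space M |B. B \<in> sets borel}" for h :: "'a \<Rightarrow> real"
      proof (rule Int_stableI)
        fix a b assume "a \<in> {h -` B \<inter> space M |B. B \<in> sets borel}"
          "b \<in> {h -` B \<inter> space M |B. B \<in> sets borel}"
        then obtain B B' where B: "B \<in> sets borel" "B' \<in> sets borel"
          "a = h -` B \<inter> space M" "b = h -` B' \<inter> space M" by auto
        then have "a \<inter> b = h -` (B \<inter> B') \<inter> space M" by auto
        with B show "a \<inter> b \<in> {h -` B \<inter> space M |B. B \<in> sets borel}" by blast
      qed
      show "Int_stable {(indicator A :: 'a \<Rightarrow> real) -` B \<inter> space M |B. B \<in> sets borel}"
        by (rule stable)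
      show "Int_stable {X -` B \<inter> space M |B. B \<in> sets borel}"
        by (rule stable)
      fix a b assume a: "a \<in> {(indicator A :: 'a \<Rightarrow> real) -` B \<inter> space M |B. B \<in> sets borel}"
        and b: "b \<in> {X -` B \<inter> space M |B. B \<in> sets borel}"
      have iF: "(indicator A :: 'a \<Rightarrow> real) \<in> borel_measurable F" using A by simp
      have "a \<in> sets F" using a measurable_sets[OF iF] F by (auto simp: subalgebra_def)
      with b show "prob (a \<inter> b) = prob a * prob b" using ind by auto
    qed
    from indep_var_lebesgue_integral[OF this _ X] integrable_real_indicator[OF A_ev] A_ev
    show "(LINT \<omega>:A|M. X \<omega>) = (LINT \<omega>:A|M. expectation X)"
      by (simp add: set_lebesgue_integral_def less_top[symmetric])
  qed (use X in auto)
qed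

lemma (in prob_space) brownian_increment:
  fixes W :: "real \<Rightarrow> 'a \<Rightarrow> real^'d"
  assumes bm: "brownian_motion M T W" and st: "0 \<le> s" "s < t" "t \<le> T"
  defines "F \<equiv> aug_filtration M W s"
  shows "all_moments M (\<lambda>\<omega>. (W t \<omega> - W s \<omega>) $ j)"
    and "AE \<omega> in M. real_cond_exp M F (\<lambda>\<omega>. (W t \<omega> - W s \<omega>) $ j) \<omega> = 0"
    and "AE \<omega> in M. real_cond_exp M F (\<lambda>\<omega>. ((W t \<omega> - W s \<omega>) $ j)\<^sup>2) \<omega> = t - s"
proof -
  let ?D = "\<lambda>\<omega>. (W t \<omega> - W s \<omega>) $ j"
  have W: "W r \<in> borel_measurable M" if "r \<in> {0..T}" for r
    using bm that by (simp add: brownian_motion_def)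
  have [measurable]: "W t \<in> borel_measurable M" "W s \<in> borel_measurable M" using W st by auto
  have sub: "subalgebra M F"
    unfolding F_def using W st by (intro subalgebra_aug_filtration) auto
  have dist: "distributed M lborel ?D (normal_density 0 (sqrt (t - s)))"
    using bm st by (simp add: brownian_motion_def)
  have pos: "0 < sqrt (t - s)" using st by simp
  show mom: "all_moments M ?D"
    unfolding all_moments_def
  proof (intro conjI allI)
    fix n :: nat
    have "integrable lborel (\<lambda>x. normal_density 0 (sqrt (t - s)) x * \<bar>x\<bar> ^ n)"
      using integrable_normal_moment_abs[OF pos, of 0 n] by simp
    then show "integrable M (\<lambda>\<omega>. norm (?D \<omega>) ^ n)"
      using distributed_integrable[OF dist, of "\<lambda>x. \<bar>x\<bar> ^ n"] pos by simp
    have "(\<lambda>x::real^'d. x $ j) \<in> borel_measurable borel" by measurable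
    then show "?D \<in> borel_measurable M"
      by (rule measurable_compose[rotated]) measurable
  qed
  have e1: "expectation ?D = 0" by (rule normal_distributed_expectation[OF pos dist])
  have e2: "expectation (\<lambda>\<omega>. (?D \<omega>)\<^sup>2) = t - s"
    using normal_distributed_variance[OF pos dist] st unfolding e1 by simp
  have ind: "prob (A \<inter> ((\<lambda>\<omega>. \<phi> (?D \<omega>)) -` C \<inter> space M)) = prob A * prob ((\<lambda>\<omega>. \<phi> (?D \<omega>)) -` C \<inter> space M)"
    if "A \<in> sets F" "C \<in> sets borel" and [measurable]: "\<phi> \<in> borel_measurable borel"
    for A C and \<phi> :: "real \<Rightarrow> real"
  proof -
    have "(\<lambda>x::real^'d. \<phi> (x $ j)) \<in> borel_measurable borel" by measurable
    from measurable_sets[OF this that(2)]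
    have "(\<lambda>x::real^'d. \<phi> (x $ j)) -` C \<in> sets borel" by simp
    from indep_increment_aug_filtration[OF bm st(1) less_imp_le[OF st(2)] st(3) _ this]
    show ?thesis using that(1) unfolding F_def by (simp add: vimage_def Int_def conj_commute)
  qed
  show "AE \<omega> in M. real_cond_exp M F ?D \<omega> = 0"
    using cond_exp_indep_const[OF sub all_moments_integrable[OF mom]] ind[of _ _ "\<lambda>x. x"] e1
    by simp
  have "integrable M (\<lambda>\<omega>. (?D \<omega>)\<^sup>2)"
    using all_moments_integrable[OF all_moments_mult[OF mom mom]] by (simp add: power2_eq_square)
  then have "AE \<omega> in M. real_cond_exp M F (\<lambda>\<omega>. (?D \<omega>)\<^sup>2) \<omega> = expectation (\<lambda>\<omega>. (?D \<omega>)\<^sup>2)"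
    by (rule cond_exp_indep_const[OF sub]) (rule ind, auto)
  then show "AE \<omega> in M. real_cond_exp M F (\<lambda>\<omega>. (?D \<omega>)\<^sup>2) \<omega> = t - s"
    unfolding e2 .
qed

section \<open>Elementary inequalities and the conditional Bessel inequality\<close>

lemma powr_add_le:
  fixes a b q :: real
  assumes "0 \<le> a" "0 \<le> b" "0 \<le> q"
  shows "(a + b) powr q \<le> 2 powr q * (a powr q + b powr q)"
proof -
  have "(a + b) powr q \<le> (2 * max a b) powr q"
    using assms by (intro powr_mono2) auto
  also have "\<dots> = 2 powr q * max a b powr q" using assms by (simp add: powr_mult)
  also have "\<dots> \<le> 2 powr q * (a powr q + b powr q)"
    by (intro mult_left_mono) (auto simp: max_def)
  finally show ?thesis .
qed

lemma powr_superadditive: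
  fixes a b p :: real
  assumes "0 \<le> a" "0 \<le> b" "1 \<le> p"
  shows "a powr p + b powr p \<le> (a + b) powr p"
proof -
  have split: "c powr p = c * c powr (p - 1)" if "0 \<le> c" for c :: real
    using that by (cases "c = 0") (simp_all add: powr_diff)
  have "a powr p + b powr p = a * a powr (p - 1) + b * b powr (p - 1)"
    using assms by (simp add: split)
  also have "\<dots> \<le> a * (a + b) powr (p - 1) + b * (a + b) powr (p - 1)"
    using assms by (intro add_mono mult_left_mono powr_mono2) auto
  also have "\<dots> = (a + b) powr p"
    using assms split[of "a + b"] by (simp add: distrib_right)
  finally show ?thesis .
qed

text \<open>With the convex weight \<open>t = \<epsilon> / (1 + 2 \<epsilon>)\<close> the sum is \<open>1 + 2 \<epsilon>\<close> times a convex combination of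
  \<open>a\<close> and \<open>b\<close>.  In contrast to a crude splitting of the power, this leaves a factor \<open>1 + O(\<epsilon>)\<close> in
  front of \<open>a powr p\<close>, which is harmless when iterated \<open>1 / \<epsilon>\<close> times.\<close>

lemma powr_perturbed_sum_le:
  fixes a b p \<epsilon> :: real
  assumes "0 \<le> a" "0 \<le> b" "1 \<le> p" "0 \<le> \<epsilon>"
  shows "((1 + \<epsilon>) * a + \<epsilon> * b) powr p \<le> exp (2 * \<epsilon> * p) * (a powr p + \<epsilon> * b powr p)"
proof -
  define t where "t = \<epsilon> / (1 + 2 * \<epsilon>)"
  have t: "0 \<le> t" "t \<le> 1" "t \<le> \<epsilon>"
    using assms by (auto simp: t_def field_simps)
  have "(1 + 2 * \<epsilon>) * ((1 - t) * a + t * b) = (1 + \<epsilon>) * a + \<epsilon> * b"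
  proof -
    have "(1 + 2 * \<epsilon>) * t = \<epsilon>" using assms by (simp add: t_def)
    moreover from this have "(1 + 2 * \<epsilon>) * (1 - t) = 1 + \<epsilon>" by (simp add: algebra_simps)
    ultimately show ?thesis by (metis distrib_left mult.assoc)
  qed
  then have "((1 + \<epsilon>) * a + \<epsilon> * b) powr p = (1 + 2 * \<epsilon>) powr p * ((1 - t) * a + t * b) powr p"
    using assms t by (metis add_nonneg_nonneg diff_ge_0_iff_ge mult_nonneg_nonneg powr_mult)
  also have "\<dots> \<le> exp (2 * \<epsilon> * p) * ((1 - t) * a powr p + t * b powr p)"
  proof (intro mult_mono)
    have "(1 + 2 * \<epsilon>) powr p \<le> exp (2 * \<epsilon>) powr p"
      using assms exp_ge_add_one_self[of "2 * \<epsilon>"] by (intro powr_mono2) auto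
    then show "(1 + 2 * \<epsilon>) powr p \<le> exp (2 * \<epsilon> * p)" by (simp add: powr_def mult.commute)
    show "((1 - t) * a + t * b) powr p \<le> (1 - t) * a powr p + t * b powr p"
      using convex_onD[OF convex_on_abs_powr[OF assms(3)], of t a b] assms t by simp
  qed (use assms t in auto)
  also have "\<dots> \<le> exp (2 * \<epsilon> * p) * (a powr p + \<epsilon> * b powr p)"
    using t by (intro mult_left_mono add_mono mult_right_mono mult_left_le_one_le) auto
  finally show ?thesis .
qed

lemma discrete_backward_gronwall:
  fixes v z :: "nat \<Rightarrow> real"
  assumes step: "\<And>i. i < N \<Longrightarrow> v i + z i \<le> exp a * (v (Suc i) + b)"
    and nonneg: "0 \<le> a" "0 \<le> b" "\<And>i. 0 \<le> z i" "0 \<le> v N"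
    and "i \<le> N"
  shows "v i + (\<Sum>j=i..<N. z j) \<le> exp (a * real N) * (v N + real N * b)"
proof -
  have "v i + (\<Sum>j=i..<N. z j) \<le> exp (a * real (N - i)) * (v N + real (N - i) * b)"
    using \<open>i \<le> N\<close>
  proof (induction i rule: inc_induct)
    case (step i)
    let ?S = "\<Sum>j=Suc i..<N. z j"
    have "v i + (\<Sum>j=i..<N. z j) = v i + z i + ?S"
      using step.hyps by (simp add: sum.atLeast_Suc_lessThan)
    also have "\<dots> \<le> exp a * (v (Suc i) + b) + ?S"
      using assms(1) step.hyps by simp
    also have "?S \<le> exp a * ?S"
      using nonneg mult_right_mono[of 1 "exp a" ?S] by (simp add: sum_nonneg)
    also have "exp a * (v (Suc i) + b) + exp a * ?S = exp a * (v (Suc i) + ?S + b)"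
      by (simp add: algebra_simps)
    also have "\<dots> \<le> exp a * (exp (a * real (N - Suc i)) * (v N + real (N - Suc i) * b)
        + exp (a * real (N - Suc i)) * b)"
      using step.IH nonneg mult_right_mono[of 1 "exp (a * real (N - Suc i))" b]
      by (intro mult_left_mono add_mono) auto
    also have "\<dots> = exp (a * real (N - i)) * (v N + real (N - i) * b)"
    proof -
      obtain n where n: "N - i = Suc n" "N - Suc i = n"
        using step.hyps by (metis Suc_diff_Suc)
      show ?thesis unfolding n by (simp add: algebra_simps exp_add)
    qed
    finally show ?case by simp
  qed simp
  also have "\<dots> \<le> exp (a * real N) * (v N + real N * b)"
    using nonneg by (intro mult_mono add_mono mult_right_mono) (auto intro: mult_left_mono)
  finally show ?thesis .
qed

text \<open>Large enough for both coefficients that the absorption in \<open>implicit_step_energy\<close> produces: \<open>9/2\<close>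
  times the growth rate \<open>L\<^sub>y + 3 d \<theta> L\<^sub>z\<^sup>2 + 1/36\<close> for \<open>|U|\<^sup>2\<close>, and \<open>9/2\<close> times \<open>9\<close> for \<open>G\<^sup>2\<close>.\<close>

definition energy_const :: "real \<Rightarrow> real \<Rightarrow> real \<Rightarrow> real \<Rightarrow> real" where
  "energy_const d \<theta> L\<^sub>y L\<^sub>z = 9/2 * (L\<^sub>y + 3 * d * \<theta> * L\<^sub>z\<^sup>2) + 41"

lemma norm_add_scaleR_power2:
  fixes u v :: "'k::real_inner"
  shows "(norm (u + c *\<^sub>R v))\<^sup>2 = (norm u)\<^sup>2 + 2 * c * (u \<bullet> v) + c\<^sup>2 * (norm v)\<^sup>2"
  unfolding power2_norm_eq_inner
  by (simp add: inner_add_left inner_add_right inner_commute[of v u] power2_eq_square algebra_simps)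

text \<open>This is where the restriction on the step is used.  Expanding \<open>|U|\<^sup>2\<close> gives
  \<open>|y|\<^sup>2 \<le> |U|\<^sup>2 + 2 \<theta> H\<close> with \<open>H = h (y \<bullet> \<phi>)\<close>, whereas the one-sided growth condition and Young's
  inequality give \<open>H \<le> h K |y|\<^sup>2 + h z\<^sup>2 / (6 d) + 9 h G\<^sup>2\<close>.  Inserting the first bound in the second,
  the coefficient \<open>2 \<theta> h K\<close> of \<open>H\<close> on the right is at most \<open>5/9\<close> and can be absorbed; multiplying by
  \<open>9/2\<close> turns \<open>1/6\<close> into the factor \<open>3/4\<close>.\<close>

lemma implicit_step_energy:
  fixes y \<phi> :: "'k::real_inner" and h \<theta> L\<^sub>y L\<^sub>z G z d :: real
  defines "U \<equiv> y - (\<theta> * h) *\<^sub>R \<phi>" and "c \<equiv> energy_const d \<theta> L\<^sub>y L\<^sub>z"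
  assumes h: "0 \<le> h" "h \<le> 1" and \<theta>: "1/2 \<le> \<theta>" "\<theta> \<le> 1" and d: "1 \<le> d"
    and nonneg: "0 \<le> L\<^sub>y"
    and small: "4 * \<theta> * (L\<^sub>y + 3 * d * \<theta> * L\<^sub>z\<^sup>2) * h \<le> 1"
    and mono: "y \<bullet> \<phi> \<le> L\<^sub>y * (norm y)\<^sup>2 + norm y * (G + L\<^sub>z * z)"
  shows "2 * h * (y \<bullet> \<phi>) \<le> c * h * (norm U)\<^sup>2 + 3/4 * (h * z\<^sup>2 / d) + c * h * G\<^sup>2"
    and "(norm y)\<^sup>2 \<le> (1 + c) * ((norm U)\<^sup>2 + h * z\<^sup>2 / d + G\<^sup>2)"
proof -
  \<comment> \<open>The summand \<open>1/36\<close> pays for the mixed term \<open>|y| G\<close>; \<open>1/2 + 2/36 = 5/9\<close> is then exactly what the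
    factor \<open>3/4\<close> tolerates.\<close>
  define K where "K = L\<^sub>y + 3 * d * \<theta> * L\<^sub>z\<^sup>2 + 1/36"
  have K: "0 \<le> K" using nonneg \<theta> d by (simp add: K_def)
  have c: "9/2 * K \<le> c" "81/2 \<le> c" "0 \<le> c"
  proof -
    have "0 \<le> 3 * d * \<theta> * L\<^sub>z\<^sup>2" using \<theta> d by simp
    then show "9/2 * K \<le> c" "81/2 \<le> c" "0 \<le> c"
      unfolding K_def c_def energy_const_def using nonneg by argo+
  qed
  define H where "H = h * (y \<bullet> \<phi>)"
  have "(norm U)\<^sup>2 = (norm y)\<^sup>2 - 2 * \<theta> * H + (\<theta> * h)\<^sup>2 * (norm \<phi>)\<^sup>2"
    using norm_add_scaleR_power2[of y "- (\<theta> * h)" \<phi>] by (simp add: U_def H_def mult.assoc)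
  then have y_le: "(norm y)\<^sup>2 \<le> (norm U)\<^sup>2 + 2 * \<theta> * H" by simp
  have yG: "norm y * G \<le> (norm y)\<^sup>2 / 36 + 9 * G\<^sup>2"
    using zero_le_power2[of "norm y / 6 - 3 * G"] by (simp add: power2_eq_square algebra_simps)
  have yz: "norm y * (L\<^sub>z * z) \<le> 3 * d * \<theta> * L\<^sub>z\<^sup>2 * (norm y)\<^sup>2 + z\<^sup>2 / (6 * d)"
  proof -
    define s where "s = 12 * d * \<theta>"
    have s: "0 < s" "6 * d \<le> s" using d \<theta> by (auto simp: s_def)
    have "0 \<le> (s * L\<^sub>z * norm y / 2 - z)\<^sup>2 / s" using s by simp
    also have "\<dots> = s / 4 * L\<^sub>z\<^sup>2 * (norm y)\<^sup>2 - norm y * (L\<^sub>z * z) + z\<^sup>2 / s"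
      using s by (simp add: power2_eq_square field_simps)
    also have "z\<^sup>2 / s \<le> z\<^sup>2 / (6 * d)"
      using s d by (intro divide_left_mono) auto
    finally show ?thesis by (simp add: s_def algebra_simps)
  qed
  have H_le: "H \<le> h * K * (norm y)\<^sup>2 + h * z\<^sup>2 / (6 * d) + 9 * h * G\<^sup>2"
  proof -
    have "y \<bullet> \<phi> \<le> K * (norm y)\<^sup>2 + z\<^sup>2 / (6 * d) + 9 * G\<^sup>2"
      using mono yG yz by (simp add: K_def algebra_simps)
    then have "h * (y \<bullet> \<phi>) \<le> h * (K * (norm y)\<^sup>2 + z\<^sup>2 / (6 * d) + 9 * G\<^sup>2)"
      using h by (intro mult_left_mono) auto
    then show ?thesis by (simp add: H_def algebra_simps)
  qed
  have "0 \<le> h * z\<^sup>2 / d" using h d by simp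
  show main: "2 * h * (y \<bullet> \<phi>) \<le> c * h * (norm U)\<^sup>2 + 3/4 * (h * z\<^sup>2 / d) + c * h * G\<^sup>2"
  proof (cases "H \<le> 0")
    case True
    have "0 \<le> c * h * (norm U)\<^sup>2 + 3/4 * (h * z\<^sup>2 / d) + c * h * G\<^sup>2"
      using c h d by simp
    with True show ?thesis by (simp add: H_def)
  next
    case False
    have "h * K * (norm y)\<^sup>2 \<le> h * K * ((norm U)\<^sup>2 + 2 * \<theta> * H)"
      using y_le h K by (intro mult_left_mono) auto
    moreover have "2 * \<theta> * (h * K) * H \<le> 5/9 * H"
    proof (rule mult_right_mono)
      have "2 * \<theta> * (h * K) = (4 * \<theta> * (L\<^sub>y + 3 * d * \<theta> * L\<^sub>z\<^sup>2) * h) / 2 + \<theta> * h / 18"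
        by (simp add: K_def field_simps)
      also have "\<dots> \<le> 1 / 2 + 1 / 18"
        using small mult_le_one[OF \<theta>(2) h] by (intro add_mono divide_right_mono) auto
      finally show "2 * \<theta> * (h * K) \<le> 5/9" by simp
    qed (use False in simp)
    ultimately have "4/9 * H \<le> h * K * (norm U)\<^sup>2 + h * z\<^sup>2 / (6 * d) + 9 * h * G\<^sup>2"
      using H_le by (simp add: algebra_simps)
    then have "2 * H \<le> (9/2 * K) * (h * (norm U)\<^sup>2) + 3/4 * (h * z\<^sup>2 / d) + 81/2 * (h * G\<^sup>2)"
      using d by (simp add: field_simps)
    also have "\<dots> \<le> c * (h * (norm U)\<^sup>2) + 3/4 * (h * z\<^sup>2 / d) + c * (h * G\<^sup>2)"
      using c h \<open>0 \<le> h * z\<^sup>2 / d\<close> by (intro add_mono mult_right_mono) auto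
    finally show ?thesis by (simp add: H_def algebra_simps)
  qed
  have "2 * \<theta> * H \<le> c * (norm U)\<^sup>2 + h * z\<^sup>2 / d + c * G\<^sup>2"
  proof (cases "H \<le> 0")
    case True
    then have "2 * \<theta> * H \<le> 0" using \<theta> by (simp add: mult_nonneg_nonpos)
    also have "0 \<le> c * (norm U)\<^sup>2 + h * z\<^sup>2 / d + c * G\<^sup>2" using c h d by simp
    finally show ?thesis .
  next
    case False
    then have "2 * \<theta> * H \<le> 2 * H" using \<theta> by simp
    also have "\<dots> \<le> c * h * (norm U)\<^sup>2 + 3/4 * (h * z\<^sup>2 / d) + c * h * G\<^sup>2"
      using main by (simp add: H_def)
    also have "\<dots> \<le> c * (norm U)\<^sup>2 + h * z\<^sup>2 / d + c * G\<^sup>2"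
    proof -
      have "3/4 * e \<le> e" if "0 \<le> e" for e :: real using that by simp
      from this[OF \<open>0 \<le> h * z\<^sup>2 / d\<close>] show ?thesis
        using c h by (intro add_mono mult_right_mono) (auto intro: mult_left_le)
    qed
    finally show ?thesis .
  qed
  with y_le have "(norm y)\<^sup>2 \<le> (1 + c) * (norm U)\<^sup>2 + h * z\<^sup>2 / d + c * G\<^sup>2"
    by (simp add: algebra_simps)
  also have "\<dots> \<le> (1 + c) * ((norm U)\<^sup>2 + h * z\<^sup>2 / d + G\<^sup>2)"
  proof -
    have "(1 + c) * u + e + c * k \<le> (1 + c) * (u + e + k)" if "0 \<le> c * e" "0 \<le> k" for u e k :: real
      using that by (simp add: algebra_simps)
    then show ?thesis
      using mult_nonneg_nonneg[OF c(3) \<open>0 \<le> h * z\<^sup>2 / d\<close>] zero_le_power2 by blast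
  qed
  finally show "(norm y)\<^sup>2 \<le> (1 + c) * ((norm U)\<^sup>2 + h * z\<^sup>2 / d + G\<^sup>2)" .
qed

text \<open>The two sides differ by \<open>(2 \<theta> - 1) h\<^sup>2 |\<phi>|\<^sup>2\<close>, which has the right sign exactly for
  \<open>\<theta> \<ge> 1/2\<close>.\<close>

lemma explicit_part_norm_le:
  fixes y \<phi> :: "'k::real_inner"
  assumes "1/2 \<le> \<theta>"
  shows "(norm (y + ((1 - \<theta>) * h) *\<^sub>R \<phi>))\<^sup>2 \<le> (norm (y - (\<theta> * h) *\<^sub>R \<phi>))\<^sup>2 + 2 * h * (y \<bullet> \<phi>)"
proof -
  define U where "U = y - (\<theta> * h) *\<^sub>R \<phi>"
  have "y + ((1 - \<theta>) * h) *\<^sub>R \<phi> = U + h *\<^sub>R \<phi>"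
    by (simp add: U_def algebra_simps)
  then have "(norm (y + ((1 - \<theta>) * h) *\<^sub>R \<phi>))\<^sup>2 = (norm U)\<^sup>2 + 2 * h * (U \<bullet> \<phi>) + h\<^sup>2 * (norm \<phi>)\<^sup>2"
    by (simp only: norm_add_scaleR_power2)
  also have "U \<bullet> \<phi> = y \<bullet> \<phi> - \<theta> * h * (norm \<phi>)\<^sup>2"
    by (simp add: U_def inner_diff_left power2_norm_eq_inner)
  also have "(norm U)\<^sup>2 + 2 * h * (y \<bullet> \<phi> - \<theta> * h * (norm \<phi>)\<^sup>2) + h\<^sup>2 * (norm \<phi>)\<^sup>2 =
      (norm U)\<^sup>2 + 2 * h * (y \<bullet> \<phi>) - (2 * \<theta> - 1) * (h\<^sup>2 * (norm \<phi>)\<^sup>2)"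
    by (simp add: power2_eq_square[of h] algebra_simps)
  also have "\<dots> \<le> (norm U)\<^sup>2 + 2 * h * (y \<bullet> \<phi>)" using assms by simp
  finally show ?thesis unfolding U_def .
qed

text \<open>The conditional expectation of the square of \<open>Q - q - z D\<close> is nonnegative, where \<open>q\<close> and \<open>z\<close> are
  the projection coefficients of \<open>Q\<close>; expand the square and pull out the measurable factors.\<close>

lemma (in finite_measure_subalgebra) cond_exp_bessel:
  assumes Q: "all_moments M Q" and D: "all_moments M D" and h: "0 < h"
    and D1: "AE \<omega> in M. real_cond_exp M F D \<omega> = 0"
    and D2: "AE \<omega> in M. real_cond_exp M F (\<lambda>\<omega>. (D \<omega>)\<^sup>2) \<omega> = h"
  shows "AE \<omega> in M. (real_cond_exp M F Q \<omega>)\<^sup>2 + h * (real_cond_exp M F (\<lambda>\<omega>. (1 / h) * (Q \<omega> * D \<omega>)) \<omega>)\<^sup>2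
    \<le> real_cond_exp M F (\<lambda>\<omega>. (Q \<omega>)\<^sup>2) \<omega>"
proof -
  let ?E = "real_cond_exp M F"
  define q where "q = ?E Q"
  define z where "z = ?E (\<lambda>\<omega>. (1 / h) * (Q \<omega> * D \<omega>))"
  have QD: "all_moments M (\<lambda>\<omega>. Q \<omega> * D \<omega>)" using Q D by (rule all_moments_mult)
  have q: "all_moments M q" unfolding q_def by (rule all_moments_real_cond_exp[OF Q])
  have z: "all_moments M z" unfolding z_def
    by (intro all_moments_real_cond_exp all_moments_mult[OF all_moments_const QD])
  have qF [measurable]: "q \<in> borel_measurable F" and zF [measurable]: "z \<in> borel_measurable F"
    by (auto simp: q_def z_def)
  note mom = all_moments_mult all_moments_const q z Q D
  note int = all_moments_integrable
  have [measurable]: "Q \<in> borel_measurable M" "D \<in> borel_measurable M"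
      "q \<in> borel_measurable M" "z \<in> borel_measurable M"
    using Q D q z by (auto dest: all_moments_measurable)
  have ti: "integrable M (\<lambda>\<omega>. Q \<omega> * Q \<omega>)" "integrable M (\<lambda>\<omega>. (- 2 * q \<omega>) * Q \<omega>)"
    "integrable M (\<lambda>\<omega>. (- 2 * z \<omega>) * (Q \<omega> * D \<omega>))" "integrable M (\<lambda>\<omega>. q \<omega> * q \<omega>)"
    "integrable M (\<lambda>\<omega>. (2 * q \<omega> * z \<omega>) * D \<omega>)" "integrable M (\<lambda>\<omega>. (z \<omega> * z \<omega>) * (D \<omega> * D \<omega>))"
    by (intro int mom)+
  have e1: "AE \<omega> in M. ?E (\<lambda>\<omega>. (- 2 * q \<omega>) * Q \<omega>) \<omega> = (- 2 * q \<omega>) * ?E Q \<omega>"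
    by (rule real_cond_exp_mult) (use ti in measurable)
  have e2: "AE \<omega> in M. ?E (\<lambda>\<omega>. (- 2 * z \<omega>) * (Q \<omega> * D \<omega>)) \<omega> = (- 2 * z \<omega>) * ?E (\<lambda>\<omega>. Q \<omega> * D \<omega>) \<omega>"
    by (rule real_cond_exp_mult) (use ti in measurable)
  have e3: "AE \<omega> in M. ?E (\<lambda>\<omega>. q \<omega> * q \<omega>) \<omega> = q \<omega> * q \<omega>"
    by (rule real_cond_exp_F_meas) (use ti in measurable)
  have e4: "AE \<omega> in M. ?E (\<lambda>\<omega>. (2 * q \<omega> * z \<omega>) * D \<omega>) \<omega> = (2 * q \<omega> * z \<omega>) * ?E D \<omega>"
    by (rule real_cond_exp_mult) (use ti in measurable)
  have e5: "AE \<omega> in M. ?E (\<lambda>\<omega>. (z \<omega> * z \<omega>) * (D \<omega> * D \<omega>)) \<omega> = (z \<omega> * z \<omega>) * ?E (\<lambda>\<omega>. D \<omega> * D \<omega>) \<omega>"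
    by (rule real_cond_exp_mult) (use ti in measurable)
  have e6: "AE \<omega> in M. z \<omega> = (1 / h) * ?E (\<lambda>\<omega>. Q \<omega> * D \<omega>) \<omega>"
    unfolding z_def by (rule real_cond_exp_cmult) (rule int[OF QD])
  have s1: "AE \<omega> in M. ?E (\<lambda>\<omega>. Q \<omega> * Q \<omega> + (- 2 * q \<omega>) * Q \<omega>) \<omega> =
      ?E (\<lambda>\<omega>. Q \<omega> * Q \<omega>) \<omega> + ?E (\<lambda>\<omega>. (- 2 * q \<omega>) * Q \<omega>) \<omega>"
    by (intro real_cond_exp_add ti)
  have s2: "AE \<omega> in M. ?E (\<lambda>\<omega>. (Q \<omega> * Q \<omega> + (- 2 * q \<omega>) * Q \<omega>) + (- 2 * z \<omega>) * (Q \<omega> * D \<omega>)) \<omega> =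
      ?E (\<lambda>\<omega>. Q \<omega> * Q \<omega> + (- 2 * q \<omega>) * Q \<omega>) \<omega> + ?E (\<lambda>\<omega>. (- 2 * z \<omega>) * (Q \<omega> * D \<omega>)) \<omega>"
    by (intro real_cond_exp_add Bochner_Integration.integrable_add ti)
  have s3: "AE \<omega> in M. ?E (\<lambda>\<omega>. q \<omega> * q \<omega> + (2 * q \<omega> * z \<omega>) * D \<omega>) \<omega> =
      ?E (\<lambda>\<omega>. q \<omega> * q \<omega>) \<omega> + ?E (\<lambda>\<omega>. (2 * q \<omega> * z \<omega>) * D \<omega>) \<omega>"
    by (intro real_cond_exp_add Bochner_Integration.integrable_add ti)
  have s4: "AE \<omega> in M. ?E (\<lambda>\<omega>. (q \<omega> * q \<omega> + (2 * q \<omega> * z \<omega>) * D \<omega>) + (z \<omega> * z \<omega>) * (D \<omega> * D \<omega>)) \<omega> =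
      ?E (\<lambda>\<omega>. q \<omega> * q \<omega> + (2 * q \<omega> * z \<omega>) * D \<omega>) \<omega> + ?E (\<lambda>\<omega>. (z \<omega> * z \<omega>) * (D \<omega> * D \<omega>)) \<omega>"
    by (intro real_cond_exp_add Bochner_Integration.integrable_add ti)
  have s5: "AE \<omega> in M. ?E (\<lambda>\<omega>. ((Q \<omega> * Q \<omega> + (- 2 * q \<omega>) * Q \<omega>) + (- 2 * z \<omega>) * (Q \<omega> * D \<omega>)) +
        ((q \<omega> * q \<omega> + (2 * q \<omega> * z \<omega>) * D \<omega>) + (z \<omega> * z \<omega>) * (D \<omega> * D \<omega>))) \<omega> =
      ?E (\<lambda>\<omega>. (Q \<omega> * Q \<omega> + (- 2 * q \<omega>) * Q \<omega>) + (- 2 * z \<omega>) * (Q \<omega> * D \<omega>)) \<omega> +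
      ?E (\<lambda>\<omega>. (q \<omega> * q \<omega> + (2 * q \<omega> * z \<omega>) * D \<omega>) + (z \<omega> * z \<omega>) * (D \<omega> * D \<omega>)) \<omega>"
    by (intro real_cond_exp_add Bochner_Integration.integrable_add ti)
  have pos: "AE \<omega> in M. 0 \<le> ?E (\<lambda>\<omega>. ((Q \<omega> * Q \<omega> + (- 2 * q \<omega>) * Q \<omega>) + (- 2 * z \<omega>) * (Q \<omega> * D \<omega>)) +
        ((q \<omega> * q \<omega> + (2 * q \<omega> * z \<omega>) * D \<omega>) + (z \<omega> * z \<omega>) * (D \<omega> * D \<omega>))) \<omega>"
  proof (rule real_cond_exp_pos)
    have "((Q \<omega> * Q \<omega> + (- 2 * q \<omega>) * Q \<omega>) + (- 2 * z \<omega>) * (Q \<omega> * D \<omega>)) +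
        ((q \<omega> * q \<omega> + (2 * q \<omega> * z \<omega>) * D \<omega>) + (z \<omega> * z \<omega>) * (D \<omega> * D \<omega>)) =
        (Q \<omega> - q \<omega> - z \<omega> * D \<omega>)\<^sup>2" for \<omega>
      by (simp add: power2_eq_square algebra_simps)
    then show "AE \<omega> in M. 0 \<le> ((Q \<omega> * Q \<omega> + (- 2 * q \<omega>) * Q \<omega>) + (- 2 * z \<omega>) * (Q \<omega> * D \<omega>)) +
        ((q \<omega> * q \<omega> + (2 * q \<omega> * z \<omega>) * D \<omega>) + (z \<omega> * z \<omega>) * (D \<omega> * D \<omega>))"
      by simp
  qed measurable
  show ?thesis
    using D1 D2 e1 e2 e3 e4 e5 e6 s1 s2 s3 s4 s5 pos
    unfolding power2_eq_square z_def[symmetric] q_def[symmetric]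
  proof eventually_elim
    case (elim \<omega>)
    have zh: "?E (\<lambda>\<omega>. Q \<omega> * D \<omega>) \<omega> = h * z \<omega>" using elim(8) h by simp
    show ?case using elim unfolding zh by (simp add: algebra_simps)
  qed
qed

lemma vec_cond_exp_inner:
  assumes "u \<in> Basis"
  shows "vec_cond_exp M F A \<omega> \<bullet> u = real_cond_exp M F (\<lambda>\<omega>. A \<omega> \<bullet> u) \<omega>"
  unfolding vec_cond_exp_def using assms by (simp add: inner_sum_left inner_Basis if_distrib sum.delta cong: if_cong)

lemma vec_cond_exp_nth:
  fixes A :: "'a \<Rightarrow> real^'k"
  shows "vec_cond_exp M F A \<omega> $ a = real_cond_exp M F (\<lambda>\<omega>. A \<omega> $ a) \<omega>"
  using vec_cond_exp_inner[of "axis a 1" M F A \<omega>] by (simp add: cart_eq_inner_axis axis_in_Basis_iff)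

lemma vec_cond_exp_nth_nth:
  fixes A :: "'a \<Rightarrow> real^'d^'k"
  shows "vec_cond_exp M F A \<omega> $ a $ j = real_cond_exp M F (\<lambda>\<omega>. A \<omega> $ a $ j) \<omega>"
  using vec_cond_exp_inner[of "axis a (axis j 1)" M F A \<omega>]
  by (simp add: inner_axis axis_in_Basis_iff)

lemma norm_vec_power2: "(norm (v :: 'b::real_inner^'k))\<^sup>2 = (\<Sum>a\<in>UNIV. (norm (v $ a))\<^sup>2)"
  by (simp add: power2_norm_eq_inner inner_vec_def)

lemma all_moments_nth:
  fixes A :: "'a \<Rightarrow> real^'k"
  shows "all_moments M A \<Longrightarrow> all_moments M (\<lambda>\<omega>. A \<omega> $ a)"
  using all_moments_inner[of M A "axis a 1"] by (simp add: cart_eq_inner_axis)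

text \<open>The scalar inequality bounds each coordinate of \<open>D\<close> by the full variance of \<open>A\<close>; averaging over
  the \<open>d\<close> coordinates is the source of the factor \<open>1 / d\<close>.\<close>

lemma (in finite_measure_subalgebra) vec_cond_exp_bessel:
  fixes A :: "'a \<Rightarrow> real^'k" and D :: "'a \<Rightarrow> real^'d"
  assumes A: "all_moments M A" and D: "\<And>j. all_moments M (\<lambda>\<omega>. D \<omega> $ j)" and h: "0 < h"
    and D1: "\<And>j. AE \<omega> in M. real_cond_exp M F (\<lambda>\<omega>. D \<omega> $ j) \<omega> = 0"
    and D2: "\<And>j. AE \<omega> in M. real_cond_exp M F (\<lambda>\<omega>. (D \<omega> $ j)\<^sup>2) \<omega> = h"
  shows "AE \<omega> in M. (norm (vec_cond_exp M F A \<omega>))\<^sup>2 +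
      h * (norm (vec_cond_exp M F (\<lambda>\<omega>. (1 / h) *\<^sub>R outer_prod (A \<omega>) (D \<omega>)) \<omega>))\<^sup>2 / real CARD('d)
    \<le> real_cond_exp M F (\<lambda>\<omega>. (norm (A \<omega>))\<^sup>2) \<omega>"
proof -
  let ?E = "real_cond_exp M F"
  let ?z = "\<lambda>a j \<omega>. ?E (\<lambda>\<omega>. (1 / h) * (A \<omega> $ a * D \<omega> $ j)) \<omega>"
  have comp: "AE \<omega> in M. \<forall>a j. (?E (\<lambda>\<omega>. A \<omega> $ a) \<omega>)\<^sup>2 + h * (?z a j \<omega>)\<^sup>2 \<le> ?E (\<lambda>\<omega>. (A \<omega> $ a)\<^sup>2) \<omega>"
    unfolding AE_all_countable
    by (intro allI cond_exp_bessel all_moments_nth A D h D1 D2)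
  have int: "integrable M (\<lambda>\<omega>. (A \<omega> $ a)\<^sup>2)" for a
    unfolding power2_eq_square by (intro all_moments_integrable all_moments_mult all_moments_nth A)
  have "AE \<omega> in M. ?E (\<lambda>\<omega>. \<Sum>a\<in>UNIV. (A \<omega> $ a)\<^sup>2) \<omega> = (\<Sum>a\<in>UNIV. ?E (\<lambda>\<omega>. (A \<omega> $ a)\<^sup>2) \<omega>)"
    by (rule real_cond_exp_sum) (rule int)
  with comp show ?thesis
  proof eventually_elim
    case (elim \<omega>)
    have "(norm (vec_cond_exp M F A \<omega>))\<^sup>2 +
        h * (norm (vec_cond_exp M F (\<lambda>\<omega>. (1 / h) *\<^sub>R outer_prod (A \<omega>) (D \<omega>)) \<omega>))\<^sup>2 / real CARD('d)
      = (\<Sum>a\<in>UNIV. (?E (\<lambda>\<omega>. A \<omega> $ a) \<omega>)\<^sup>2) + h * (\<Sum>a\<in>UNIV. \<Sum>j\<in>(UNIV::'d set). (?z a j \<omega>)\<^sup>2) / real CARD('d)"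
      by (simp add: norm_vec_power2 vec_cond_exp_nth vec_cond_exp_nth_nth outer_prod_def)
    also have "\<dots> = (\<Sum>a\<in>UNIV. \<Sum>j\<in>(UNIV::'d set). ((?E (\<lambda>\<omega>. A \<omega> $ a) \<omega>)\<^sup>2 + h * (?z a j \<omega>)\<^sup>2) / real CARD('d))"
      by (simp add: sum_divide_distrib[symmetric] sum.distrib sum_distrib_left add_divide_distrib)
    also have "\<dots> \<le> (\<Sum>a\<in>UNIV. \<Sum>j\<in>(UNIV::'d set). ?E (\<lambda>\<omega>. (A \<omega> $ a)\<^sup>2) \<omega> / real CARD('d))"
      using elim(1) by (intro sum_mono divide_right_mono) auto
    also have "\<dots> = ?E (\<lambda>\<omega>. \<Sum>a\<in>UNIV. (A \<omega> $ a)\<^sup>2) \<omega>"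
      using elim(2) by simp
    finally show ?case by (simp add: norm_vec_power2)
  qed
qed

section \<open>The energy estimate for the scheme\<close>

text \<open>Monotonicity between \<open>y\<close> and \<open>0\<close>: the superlinear part of the growth bound vanishes at
  \<open>0\<close>.\<close>

lemma driver_growth_inner:
  assumes mg: "monotone_growth T m L L\<^sub>t L\<^sub>x L\<^sub>y L\<^sub>z g f" and t: "t \<in> {0..T}"
  shows "y \<bullet> f t x y z \<le> L\<^sub>y * (norm y)\<^sup>2 + norm y * ((L + L\<^sub>x * norm x) + L\<^sub>z * norm z)"
proof -
  have "(y - 0) \<bullet> (f t x y z - f t x 0 z) \<le> L\<^sub>y * (norm (y - 0))\<^sup>2"
    using mg t unfolding monotone_growth_def by blast
  moreover have "y \<bullet> f t x 0 z \<le> norm y * ((L + L\<^sub>x * norm x) + L\<^sub>z * norm z)"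
  proof -
    have "norm (f t x 0 z) \<le> L + L\<^sub>x * norm x + L\<^sub>y * norm (0::real^'b) powr m + L\<^sub>z * norm z"
      using mg t unfolding monotone_growth_def by blast
    then have "norm y * norm (f t x 0 z) \<le> norm y * ((L + L\<^sub>x * norm x) + L\<^sub>z * norm z)"
      by (intro mult_left_mono) auto
    then show ?thesis using norm_cauchy_schwarz order_trans by blast
  qed
  ultimately show ?thesis by (simp add: inner_diff_right)
qed

lemma driver_measurable:
  fixes f :: "real \<Rightarrow> real^'d \<Rightarrow> real^'k \<Rightarrow> real^'d^'k \<Rightarrow> real^'k"
  assumes mg: "monotone_growth T m L L\<^sub>t L\<^sub>x L\<^sub>y L\<^sub>z g f" and t: "t \<in> {0..T}"
    and "\<xi> \<in> borel_measurable M" "\<eta> \<in> borel_measurable M" "\<zeta> \<in> borel_measurable M"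
  shows "(\<lambda>\<omega>. f t (\<xi> \<omega>) (\<eta> \<omega>) (\<zeta> \<omega>)) \<in> borel_measurable M"
proof -
  have "continuous_on ({0..T} \<times> UNIV \<times> UNIV \<times> UNIV) (\<lambda>(t, x, y, z). f t x y z)"
    using mg by (simp add: monotone_growth_def)
  then have "continuous_on UNIV ((\<lambda>(t, x, y, z). f t x y z) \<circ> (\<lambda>u. (t, u)))"
    by (rule continuous_on_compose2[unfolded o_def[symmetric]]) (use t in \<open>auto intro!: continuous_intros\<close>)
  then have "(\<lambda>(x, y, z). f t x y z) \<in> borel_measurable borel"
    by (intro borel_measurable_continuous_onI) (simp add: o_def case_prod_unfold)
  moreover have "(\<lambda>\<omega>. (\<xi> \<omega>, \<eta> \<omega>, \<zeta> \<omega>)) \<in> borel_measurable M"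
    using assms(3-5) by measurable
  ultimately have "(\<lambda>\<omega>. (\<lambda>(x, y, z). f t x y z) (\<xi> \<omega>, \<eta> \<omega>, \<zeta> \<omega>)) \<in> borel_measurable M"
    by (rule measurable_compose[rotated])
  then show ?thesis by simp
qed

lemma (in finite_measure) all_moments_driver:
  fixes f :: "real \<Rightarrow> real^'d \<Rightarrow> real^'k \<Rightarrow> real^'d^'k \<Rightarrow> real^'k"
  assumes mg: "monotone_growth T m L L\<^sub>t L\<^sub>x L\<^sub>y L\<^sub>z g f" and t: "t \<in> {0..T}" and "0 \<le> m"
    and mom: "all_moments M \<xi>" "all_moments M \<eta>" "all_moments M \<zeta>"
  shows "all_moments M (\<lambda>\<omega>. f t (\<xi> \<omega>) (\<eta> \<omega>) (\<zeta> \<omega>))"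
proof (rule all_moments_bound)
  show "all_moments M (\<lambda>\<omega>. L + L\<^sub>x * norm (\<xi> \<omega>) + L\<^sub>y * norm (\<eta> \<omega>) powr m + L\<^sub>z * norm (\<zeta> \<omega>))"
    by (intro all_moments_add all_moments_mult all_moments_const all_moments_norm all_moments_powr
        mom \<open>0 \<le> m\<close>)
  show "(\<lambda>\<omega>. f t (\<xi> \<omega>) (\<eta> \<omega>) (\<zeta> \<omega>)) \<in> borel_measurable M"
    by (intro driver_measurable[OF mg t] mom[THEN all_moments_measurable])
  have "norm (f t x y z) \<le> L + L\<^sub>x * norm x + L\<^sub>y * norm y powr m + L\<^sub>z * norm z" for x y z
    using mg t unfolding monotone_growth_def by blast
  then have "norm (f t x y z) \<le> norm (L + L\<^sub>x * norm x + L\<^sub>y * norm y powr m + L\<^sub>z * norm z)" for x y z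
    by (metis abs_ge_self order_trans real_norm_def)
  then show "AE \<omega> in M. norm (f t (\<xi> \<omega>) (\<eta> \<omega>) (\<zeta> \<omega>)) \<le>
      norm (L + L\<^sub>x * norm (\<xi> \<omega>) + L\<^sub>y * norm (\<eta> \<omega>) powr m + L\<^sub>z * norm (\<zeta> \<omega>))"
    by blast
qed

lemma lipschitz_linear_growth:
  fixes g :: "'b::real_normed_vector \<Rightarrow> 'c::real_normed_vector"
  assumes "C-lipschitz_on UNIV g"
  shows "norm (g x) \<le> norm (g 0) + C * norm x"
proof -
  have "norm (g x) \<le> norm (g 0) + norm (g x - g 0)" by (metis norm_triangle_sub)
  also have "norm (g x - g 0) \<le> C * norm x"
    using lipschitz_onD[OF assms, of x 0] by (simp add: dist_norm)
  finally show ?thesis by simp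
qed

text \<open>One output of the scheme for a fixed number of steps; \<open>\<xi>\<close> approximates the forward process.
  The restriction on the step is kept in the multiplied-out form in which it enters the energy
  estimate.\<close>

locale theta_scheme_output = prob_space M
  for M :: "'a measure" +
  fixes W :: "real \<Rightarrow> 'a \<Rightarrow> real^'d"
    and \<xi> :: "nat \<Rightarrow> 'a \<Rightarrow> real^'d"
    and g :: "real^'d \<Rightarrow> real^'k"
    and f :: "real \<Rightarrow> real^'d \<Rightarrow> real^'k \<Rightarrow> real^'d^'k \<Rightarrow> real^'k"
    and T m L L\<^sub>t L\<^sub>x L\<^sub>y L\<^sub>z \<theta> :: real and N :: nat
    and Y :: "nat \<Rightarrow> 'a \<Rightarrow> real^'k" and Z :: "nat \<Rightarrow> 'a \<Rightarrow> real^'d^'k"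
  assumes T_pos: "0 < T" and N_pos: "1 \<le> N" and m_ge: "1 \<le> m"
    and theta: "1/2 \<le> \<theta>" "\<theta> \<le> 1"
    and bm: "brownian_motion M T W"
    and mg: "monotone_growth T m L L\<^sub>t L\<^sub>x L\<^sub>y L\<^sub>z g f"
    and forward_moments: "\<And>i. i \<le> N \<Longrightarrow> all_moments M (\<xi> i)"
    and step_le: "T / real N \<le> 1" "4 * \<theta> * (L\<^sub>y + 3 * real CARD('d) * \<theta> * L\<^sub>z\<^sup>2) * (T / real N) \<le> 1"
    and scheme: "theta_scheme M (aug_filtration M W) W T \<theta> g f N \<xi> Y Z"
begin

definition "h = T / real N"
definition "\<tau> = grid T N"
definition "\<F> i = aug_filtration M W (\<tau> i)"
definition "\<Delta>W i \<omega> = W (\<tau> (Suc i)) \<omega> - W (\<tau> i) \<omega>"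
definition "\<phi> i \<omega> = f (\<tau> i) (\<xi> i \<omega>) (Y i \<omega>) (Z i \<omega>)"
definition "A i \<omega> = Y (Suc i) \<omega> + ((1 - \<theta>) * h) *\<^sub>R \<phi> (Suc i) \<omega>"
definition "U i \<omega> = Y i \<omega> - (\<theta> * h) *\<^sub>R \<phi> i \<omega>"
definition "G i \<omega> = L + L\<^sub>x * norm (\<xi> i \<omega>)"

text \<open>The energy has to contain as much of \<open>h |Z|\<^sup>2 / d\<close> as \<open>driver_le\<close> loses at the same time level,
  and less than the full amount that the Bessel inequality gains.\<close>

definition "V i \<omega> = (norm (U i \<omega>))\<^sup>2 + 3/4 * (h * (norm (Z i \<omega>))\<^sup>2 / real CARD('d))"
definition "\<kappa> = energy_const (real CARD('d)) \<theta> L\<^sub>y L\<^sub>z"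

lemma consts_pos: "L > 0" "L\<^sub>t > 0" "L\<^sub>x > 0" "L\<^sub>y > 0" "L\<^sub>z > 0"
  using mg by (simp_all add: monotone_growth_def)

lemma h_pos: "0 < h" and h_le: "h \<le> 1"
  using T_pos N_pos step_le by (auto simp: h_def)

lemma card_pos: "1 \<le> real CARD('d)"
  by (simp add: Suc_leI)

lemma kappa_pos: "0 < \<kappa>"
proof -
  have "0 \<le> 3 * real CARD('d) * \<theta> * L\<^sub>z\<^sup>2" using theta by simp
  then show ?thesis unfolding \<kappa>_def energy_const_def using consts_pos(4) by argo
qed

lemma tau_eq: "\<tau> i = real i * h"
  by (simp add: \<tau>_def grid_def h_def)

lemma tau_Suc: "\<tau> (Suc i) - \<tau> i = h"
  by (simp add: tau_eq algebra_simps)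

lemma tau_in: "i \<le> N \<Longrightarrow> \<tau> i \<in> {0..T}"
  using T_pos N_pos by (auto simp: \<tau>_def grid_def field_simps)

lemma subalgebra_F: "i \<le> N \<Longrightarrow> subalgebra M (\<F> i)"
  unfolding \<F>_def using bm tau_in[of i]
  by (intro subalgebra_aug_filtration) (auto simp: brownian_motion_def)

lemma filtration: "i \<le> N \<Longrightarrow> finite_measure_subalgebra M (\<F> i)"
  using subalgebra_F by unfold_locales

lemma increment:
  assumes "i < N"
  shows "all_moments M (\<lambda>\<omega>. \<Delta>W i \<omega> $ j)"
    and "AE \<omega> in M. real_cond_exp M (\<F> i) (\<lambda>\<omega>. \<Delta>W i \<omega> $ j) \<omega> = 0"
    and "AE \<omega> in M. real_cond_exp M (\<F> i) (\<lambda>\<omega>. (\<Delta>W i \<omega> $ j)\<^sup>2) \<omega> = h"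
proof -
  have s: "0 \<le> \<tau> i" "\<tau> i < \<tau> (Suc i)" "\<tau> (Suc i) \<le> T"
    using tau_in[of i] tau_in[of "Suc i"] tau_Suc[of i] h_pos assms by auto
  note b = brownian_increment[OF bm s, of j]
  show "all_moments M (\<lambda>\<omega>. \<Delta>W i \<omega> $ j)"
    and "AE \<omega> in M. real_cond_exp M (\<F> i) (\<lambda>\<omega>. \<Delta>W i \<omega> $ j) \<omega> = 0"
    and "AE \<omega> in M. real_cond_exp M (\<F> i) (\<lambda>\<omega>. (\<Delta>W i \<omega> $ j)\<^sup>2) \<omega> = h"
    using b unfolding \<Delta>W_def \<F>_def tau_Suc by auto
qed

lemma scheme_measurable:
  assumes "i \<le> N"
  shows "Y i \<in> borel_measurable M" "Z i \<in> borel_measurable M"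
proof -
  have "Y i \<in> borel_measurable (\<F> i)" "Z i \<in> borel_measurable (\<F> i)"
    using scheme assms by (auto simp: theta_scheme_def Let_def \<F>_def \<tau>_def)
  then show "Y i \<in> borel_measurable M" "Z i \<in> borel_measurable M"
    using measurable_from_subalg[OF subalgebra_F[OF assms]] by auto
qed

lemma scheme_terminal: "AE \<omega> in M. Y N \<omega> = g (\<xi> N \<omega>) \<and> Z N \<omega> = 0"
  using scheme by (simp add: theta_scheme_def Let_def)

lemma scheme_step:
  assumes "i < N"
  shows scheme_step_Z: "AE \<omega> in M. Z i \<omega> =
      vec_cond_exp M (\<F> i) (\<lambda>\<omega>. (1 / h) *\<^sub>R outer_prod (A i \<omega>) (\<Delta>W i \<omega>)) \<omega>"
    and scheme_step_U: "AE \<omega> in M. U i \<omega> = vec_cond_exp M (\<F> i) (A i) \<omega>"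
proof -
  have "(AE \<omega> in M. Z i \<omega> =
      vec_cond_exp M (\<F> i) (\<lambda>\<omega>. (1 / h) *\<^sub>R outer_prod (A i \<omega>) (\<Delta>W i \<omega>)) \<omega>) \<and>
    (AE \<omega> in M. Y i \<omega> = vec_cond_exp M (\<F> i) (A i) \<omega> + (\<theta> * h) *\<^sub>R \<phi> i \<omega>)"
    using scheme assms
    unfolding theta_scheme_def Let_def \<F>_def \<tau>_def h_def \<phi>_def[abs_def] A_def[abs_def] \<Delta>W_def[abs_def]
    by blast
  then show "AE \<omega> in M. Z i \<omega> =
      vec_cond_exp M (\<F> i) (\<lambda>\<omega>. (1 / h) *\<^sub>R outer_prod (A i \<omega>) (\<Delta>W i \<omega>)) \<omega>"
    and "AE \<omega> in M. U i \<omega> = vec_cond_exp M (\<F> i) (A i) \<omega>"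
    by (auto simp: U_def)
qed

lemma driver_le:
  assumes "i \<le> N"
  shows "2 * h * (Y i \<omega> \<bullet> \<phi> i \<omega>) \<le> \<kappa> * h * (norm (U i \<omega>))\<^sup>2
      + 3/4 * (h * (norm (Z i \<omega>))\<^sup>2 / real CARD('d)) + \<kappa> * h * (G i \<omega>)\<^sup>2"
    and "(norm (Y i \<omega>))\<^sup>2 \<le> (1 + \<kappa>) * ((norm (U i \<omega>))\<^sup>2 + h * (norm (Z i \<omega>))\<^sup>2 / real CARD('d) + (G i \<omega>)\<^sup>2)"
proof -
  have "Y i \<omega> \<bullet> \<phi> i \<omega> \<le> L\<^sub>y * (norm (Y i \<omega>))\<^sup>2 + norm (Y i \<omega>) * (G i \<omega> + L\<^sub>z * norm (Z i \<omega>))"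
    unfolding \<phi>_def G_def by (rule driver_growth_inner[OF mg tau_in[OF assms]])
  then show "2 * h * (Y i \<omega> \<bullet> \<phi> i \<omega>) \<le> \<kappa> * h * (norm (U i \<omega>))\<^sup>2
      + 3/4 * (h * (norm (Z i \<omega>))\<^sup>2 / real CARD('d)) + \<kappa> * h * (G i \<omega>)\<^sup>2"
    and "(norm (Y i \<omega>))\<^sup>2 \<le> (1 + \<kappa>) * ((norm (U i \<omega>))\<^sup>2 + h * (norm (Z i \<omega>))\<^sup>2 / real CARD('d) + (G i \<omega>)\<^sup>2)"
    unfolding U_def \<kappa>_def
    using implicit_step_energy[of h \<theta> "real CARD('d)" L\<^sub>y L\<^sub>z "Y i \<omega>" "\<phi> i \<omega>" "G i \<omega>" "norm (Z i \<omega>)"]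
      h_pos h_le theta card_pos consts_pos step_le(2)[folded h_def] by auto
qed

lemma moments_phi:
  assumes "i \<le> N" "all_moments M (Y i)" "all_moments M (Z i)"
  shows "all_moments M (\<phi> i)"
  unfolding \<phi>_def[abs_def]
  by (rule all_moments_driver[OF mg tau_in[OF assms(1)] _ forward_moments[OF assms(1)] assms(2,3)])
    (use m_ge in simp)

lemma moments_A:
  assumes "i < N" "all_moments M (Y (Suc i))" "all_moments M (Z (Suc i))"
  shows "all_moments M (A i)"
  unfolding A_def[abs_def]
  by (intro all_moments_add all_moments_scaleR moments_phi assms(2,3)) (use assms in auto)

lemma all_moments_outer_prod:
  assumes A: "all_moments M B" and D: "\<And>j. all_moments M (\<lambda>\<omega>. D \<omega> $ j)"
  shows "all_moments M (\<lambda>\<omega>. outer_prod (B \<omega> :: real^'k) (D \<omega> :: real^'d))"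
proof -
  have eq: "outer_prod (B \<omega>) (D \<omega>) = (\<Sum>a\<in>UNIV. \<Sum>j\<in>UNIV. (B \<omega> $ a * D \<omega> $ j) *\<^sub>R axis a (axis j 1))" for \<omega>
  proof -
    have "(\<Sum>a\<in>UNIV. \<Sum>j\<in>UNIV. (B \<omega> $ a * D \<omega> $ j) *\<^sub>R axis a (axis j 1)) $ a' $ j' = B \<omega> $ a' * D \<omega> $ j'"
      for a' :: 'k and j' :: 'd
    proof -
      have inner: "(\<Sum>j\<in>UNIV. (B \<omega> $ a * D \<omega> $ j) * (axis a (axis j 1) $ a' $ j')) =
          (if a = a' then B \<omega> $ a * D \<omega> $ j' else 0)" for a
        by (cases "a = a'") (simp_all add: axis_def if_distrib cong: if_cong)
      show ?thesis by (simp add: inner)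
    qed
    then show ?thesis by (simp add: outer_prod_def vec_eq_iff)
  qed
  show ?thesis
    unfolding eq by (intro all_moments_sum all_moments_scaleR_left all_moments_mult all_moments_nth A D)
qed

text \<open>Backward induction.  Given the moments at time \<open>i + 1\<close>, those of \<open>Z\<^sub>i\<close> and of \<open>U\<^sub>i\<close> are moments of
  conditional expectations, and \<open>Y\<^sub>i\<close>, which solves an implicit equation, is bounded in terms of
  them by the energy estimate.\<close>

lemma moments_YZ:
  assumes "i \<le> N"
  shows "all_moments M (Y i) \<and> all_moments M (Z i)"
  using assms
proof (induction i rule: inc_induct)
  case base
  have "all_moments M (Z N)"
    by (rule all_moments_bound[OF all_moments_const[of "0::real"]])
      (use scheme_terminal scheme_measurable in auto)
  moreover have "all_moments M (Y N)"
  proof -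
    obtain Lg where Lg: "Lg-lipschitz_on UNIV g" using mg by (auto simp: monotone_growth_def)
    have "norm (g x) \<le> norm (norm (g 0) + Lg * norm x)" for x
      using lipschitz_linear_growth[OF Lg, of x] by simp
    then have "AE \<omega> in M. norm (Y N \<omega>) \<le> norm (norm (g 0) + Lg * norm (\<xi> N \<omega>))"
      using scheme_terminal by auto
    moreover have "all_moments M (\<lambda>\<omega>. norm (g 0) + Lg * norm (\<xi> N \<omega>))"
      by (intro all_moments_add all_moments_mult all_moments_const all_moments_norm forward_moments) simp
    ultimately show ?thesis using scheme_measurable(1)[of N] by (auto intro: all_moments_bound)
  qed
  ultimately show ?case by simp
next
  case (step i)
  interpret finite_measure_subalgebra M "\<F> i" using filtration step by simp
  have A: "all_moments M (A i)" using moments_A step by simp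
  have Z: "all_moments M (Z i)"
  proof (rule all_moments_bound)
    show "all_moments M (vec_cond_exp M (\<F> i) (\<lambda>\<omega>. (1 / h) *\<^sub>R outer_prod (A i \<omega>) (\<Delta>W i \<omega>)))"
      by (intro all_moments_vec_cond_exp all_moments_scaleR all_moments_outer_prod A increment step)
  qed (use scheme_measurable scheme_step_Z[of i] step in auto)
  have vec: "all_moments M (\<lambda>\<omega>. vec_cond_exp M (\<F> i) (A i) \<omega>)"
    by (rule all_moments_vec_cond_exp[OF A])
  have Y: "all_moments M (Y i)"
  proof (rule all_moments_bound)
    let ?B = "\<lambda>\<omega>. 1 + (1 + \<kappa>) * (norm (vec_cond_exp M (\<F> i) (A i) \<omega>) * norm (vec_cond_exp M (\<F> i) (A i) \<omega>)
      + (h / real CARD('d)) * (norm (Z i \<omega>) * norm (Z i \<omega>)) + G i \<omega> * G i \<omega>)"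
    show "all_moments M ?B"
      unfolding G_def using step.hyps
      by (intro all_moments_add all_moments_mult all_moments_const all_moments_norm vec Z forward_moments) auto
    show "AE \<omega> in M. norm (Y i \<omega>) \<le> norm (?B \<omega>)"
      using scheme_step_U[of i, OF step.hyps(2)]
    proof eventually_elim
      case (elim \<omega>)
      have "2 * norm (Y i \<omega>) \<le> 1 + (norm (Y i \<omega>))\<^sup>2"
        using zero_le_power2[of "norm (Y i \<omega>) - 1"] by (simp add: power2_diff)
      moreover have "(norm (Y i \<omega>))\<^sup>2 \<le> (1 + \<kappa>) * ((norm (U i \<omega>))\<^sup>2 + h * (norm (Z i \<omega>))\<^sup>2 / real CARD('d) + (G i \<omega>)\<^sup>2)"
        using driver_le(2)[of i \<omega>] step by simp
      ultimately have "norm (Y i \<omega>) \<le> 1 + (1 + \<kappa>) * ((norm (U i \<omega>))\<^sup>2 + h * (norm (Z i \<omega>))\<^sup>2 / real CARD('d) + (G i \<omega>)\<^sup>2)"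
        using norm_ge_zero[of "Y i \<omega>"] by linarith
      then have "norm (Y i \<omega>) \<le> ?B \<omega>"
        using elim by (simp add: power2_eq_square)
      then show ?case by simp
    qed
  qed (use scheme_measurable step in auto)
  from Y Z show ?case by simp
qed

lemma moments_U: "i \<le> N \<Longrightarrow> all_moments M (U i)"
  unfolding U_def[abs_def]
  by (intro all_moments_diff all_moments_scaleR moments_phi) (auto simp: moments_YZ)

lemma moments_G: "i \<le> N \<Longrightarrow> all_moments M (G i)"
  unfolding G_def[abs_def]
  by (intro all_moments_add all_moments_mult all_moments_const all_moments_norm forward_moments)

lemma moments_norm2Z: "i \<le> N \<Longrightarrow> all_moments M (\<lambda>\<omega>. c * (h * (norm (Z i \<omega>))\<^sup>2 / real CARD('d)))"
proof -
  assume "i \<le> N"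
  then have "all_moments M (\<lambda>\<omega>. (c * h / real CARD('d)) * (norm (Z i \<omega>) * norm (Z i \<omega>)))"
    by (intro all_moments_mult all_moments_const all_moments_norm) (auto simp: moments_YZ)
  then show ?thesis by (simp add: power2_eq_square mult.assoc)
qed

lemma moments_V: "i \<le> N \<Longrightarrow> all_moments M (V i)"
  unfolding V_def[abs_def]
  by (intro all_moments_add moments_norm2Z) (auto simp: power2_eq_square intro!: all_moments_mult all_moments_norm moments_U)

lemma V_nonneg: "0 \<le> V i \<omega>" and G_nonneg: "0 \<le> G i \<omega>"
  using h_pos consts_pos by (auto simp: V_def G_def)

lemma energy_step:
  assumes "i < N"
  shows "AE \<omega> in M. V i \<omega> + 1/4 * (h * (norm (Z i \<omega>))\<^sup>2 / real CARD('d)) \<le>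
    real_cond_exp M (\<F> i) (\<lambda>\<omega>. (1 + \<kappa> * h) * V (Suc i) \<omega> + \<kappa> * h * (G (Suc i) \<omega>)\<^sup>2) \<omega>"
proof -
  interpret finite_measure_subalgebra M "\<F> i" using filtration assms by simp
  have i: "i \<le> N" "Suc i \<le> N" using assms by auto
  have A: "all_moments M (A i)" using moments_A assms moments_YZ[OF i(2)] by simp
  have A2: "integrable M (\<lambda>\<omega>. (norm (A i \<omega>))\<^sup>2)"
    unfolding power2_eq_square by (intro all_moments_integrable all_moments_mult all_moments_norm A)
  have R: "integrable M (\<lambda>\<omega>. (1 + \<kappa> * h) * V (Suc i) \<omega> + \<kappa> * h * (G (Suc i) \<omega>)\<^sup>2)"
    unfolding power2_eq_square
    by (intro all_moments_integrable all_moments_add all_moments_mult all_moments_const moments_V moments_G i)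
  have "(norm (A i \<omega>))\<^sup>2 \<le> (1 + \<kappa> * h) * V (Suc i) \<omega> + \<kappa> * h * (G (Suc i) \<omega>)\<^sup>2" for \<omega>
  proof -
    have "(norm (A i \<omega>))\<^sup>2 \<le> (norm (U (Suc i) \<omega>))\<^sup>2 + 2 * h * (Y (Suc i) \<omega> \<bullet> \<phi> (Suc i) \<omega>)"
      unfolding A_def U_def by (rule explicit_part_norm_le[OF theta(1)])
    also have "\<dots> \<le> V (Suc i) \<omega> + \<kappa> * h * (norm (U (Suc i) \<omega>))\<^sup>2 + \<kappa> * h * (G (Suc i) \<omega>)\<^sup>2"
      using driver_le(1)[OF i(2), of \<omega>] by (simp add: V_def)
    also have "\<kappa> * h * (norm (U (Suc i) \<omega>))\<^sup>2 \<le> \<kappa> * h * V (Suc i) \<omega>"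
      using kappa_pos h_pos by (intro mult_left_mono) (auto simp: V_def)
    finally show ?thesis by (simp add: algebra_simps)
  qed
  then have "AE \<omega> in M. real_cond_exp M (\<F> i) (\<lambda>\<omega>. (norm (A i \<omega>))\<^sup>2) \<omega> \<le>
      real_cond_exp M (\<F> i) (\<lambda>\<omega>. (1 + \<kappa> * h) * V (Suc i) \<omega> + \<kappa> * h * (G (Suc i) \<omega>)\<^sup>2) \<omega>"
    by (intro real_cond_exp_mono A2 R) simp
  moreover note vec_cond_exp_bessel[OF A increment(1)[OF assms] h_pos increment(2,3)[OF assms]]
    scheme_step[OF assms]
  ultimately show ?thesis
    by eventually_elim (simp add: V_def)
qed

text \<open>Superadditivity, Jensen's inequality and \<open>powr_perturbed_sum_le\<close> with \<open>\<epsilon> = \<kappa> h\<close>, in this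
  order.\<close>

lemma energy_moment_step:
  assumes "i < N" "1 \<le> p"
  shows "(LINT \<omega>|M. V i \<omega> powr p) + (LINT \<omega>|M. (1/4 * (h * (norm (Z i \<omega>))\<^sup>2 / real CARD('d))) powr p)
    \<le> exp (2 * (\<kappa> * h) * p) * ((LINT \<omega>|M. V (Suc i) \<omega> powr p)
        + \<kappa> * h * (LINT \<omega>|M. G (Suc i) \<omega> powr (2 * p)))"
proof -
  interpret finite_measure_subalgebra M "\<F> i" using filtration assms by simp
  have i: "i \<le> N" "Suc i \<le> N" using assms by auto
  let ?z = "\<lambda>\<omega>. 1/4 * (h * (norm (Z i \<omega>))\<^sup>2 / real CARD('d))"
  let ?R = "\<lambda>\<omega>. (1 + \<kappa> * h) * V (Suc i) \<omega> + \<kappa> * h * (G (Suc i) \<omega>)\<^sup>2"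
  have z: "all_moments M ?z" by (rule moments_norm2Z[OF i(1)])
  have z_nonneg: "0 \<le> ?z \<omega>" for \<omega> using h_pos by simp
  have R: "all_moments M ?R"
    unfolding power2_eq_square
    by (intro all_moments_add all_moments_mult all_moments_const moments_V moments_G i)
  have R_nonneg: "0 \<le> ?R \<omega>" for \<omega>
    using kappa_pos h_pos V_nonneg by simp
  have "(LINT \<omega>|M. V i \<omega> powr p) + (LINT \<omega>|M. ?z \<omega> powr p) = (LINT \<omega>|M. V i \<omega> powr p + ?z \<omega> powr p)"
    using assms(2) i z_nonneg V_nonneg
    by (intro Bochner_Integration.integral_add[symmetric] all_moments_integrable all_moments_powr_nonneg z moments_V) auto
  also have "\<dots> \<le> (LINT \<omega>|M. (V i \<omega> + ?z \<omega>) powr p)"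
    using assms(2) i z_nonneg V_nonneg
    by (intro integral_mono all_moments_integrable all_moments_add all_moments_powr_nonneg z moments_V powr_superadditive add_nonneg_nonneg) auto
  also have "\<dots> \<le> (LINT \<omega>|M. \<bar>?R \<omega>\<bar> powr p)"
  proof (rule integral_powr_le_of_le_cond_exp[OF assms(2) all_moments_integrable[OF R] _ _ _ energy_step[OF assms(1)]])
    show "integrable M (\<lambda>\<omega>. \<bar>?R \<omega>\<bar> powr p)"
      using all_moments_integrable[OF all_moments_powr[OF R, unfolded real_norm_def]] assms(2) by simp
    show "(\<lambda>\<omega>. V i \<omega> + ?z \<omega>) \<in> borel_measurable M"
      by (intro all_moments_measurable all_moments_add z moments_V i)
    show "AE \<omega> in M. 0 \<le> V i \<omega> + ?z \<omega>"
      by (intro AE_I2 add_nonneg_nonneg z_nonneg V_nonneg)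
  qed
  also have "\<dots> \<le> (LINT \<omega>|M. exp (2 * (\<kappa> * h) * p) * (V (Suc i) \<omega> powr p + \<kappa> * h * G (Suc i) \<omega> powr (2 * p)))"
  proof (rule integral_mono)
    show "integrable M (\<lambda>\<omega>. \<bar>?R \<omega>\<bar> powr p)"
      using all_moments_integrable[OF all_moments_powr[OF R, unfolded real_norm_def]] assms(2) by simp
    show "integrable M (\<lambda>\<omega>. exp (2 * (\<kappa> * h) * p) * (V (Suc i) \<omega> powr p + \<kappa> * h * G (Suc i) \<omega> powr (2 * p)))"
      by (intro all_moments_integrable all_moments_mult all_moments_add all_moments_const all_moments_powr_nonneg moments_V moments_G
          V_nonneg G_nonneg i) (use assms in auto)
    fix \<omega>
    have G2: "((G (Suc i) \<omega>)\<^sup>2) powr p = G (Suc i) \<omega> powr (2 * p)"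
      using G_nonneg[of "Suc i" \<omega>] by (simp add: powr_powr flip: powr_numeral)
    show "\<bar>?R \<omega>\<bar> powr p \<le> exp (2 * (\<kappa> * h) * p) * (V (Suc i) \<omega> powr p + \<kappa> * h * G (Suc i) \<omega> powr (2 * p))"
      using powr_perturbed_sum_le[of "V (Suc i) \<omega>" "(G (Suc i) \<omega>)\<^sup>2" p "\<kappa> * h"] R_nonneg[of \<omega>]
        V_nonneg[of "Suc i" \<omega>] kappa_pos h_pos assms(2) by (simp add: G2)
  qed
  also have "\<dots> = exp (2 * (\<kappa> * h) * p) * ((LINT \<omega>|M. V (Suc i) \<omega> powr p)
        + \<kappa> * h * (LINT \<omega>|M. G (Suc i) \<omega> powr (2 * p)))"
  proof -
    have "integrable M (\<lambda>\<omega>. V (Suc i) \<omega> powr p)" "integrable M (\<lambda>\<omega>. G (Suc i) \<omega> powr (2 * p))"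
      by (intro all_moments_integrable all_moments_powr_nonneg moments_V moments_G V_nonneg G_nonneg i; use assms in simp)+
    then show ?thesis by simp
  qed
  finally show ?thesis .
qed

end

section \<open>Moment bounds\<close>

context theta_scheme_output
begin

text \<open>Over \<open>N\<close> steps the factors \<open>exp (2 \<kappa> h p)\<close> multiply to \<open>exp (2 \<kappa> p T)\<close>, independently of
  \<open>N\<close>.\<close>

lemma scheme_moment_bound:
  fixes p \<beta> :: real
  defines "B \<equiv> exp (2 * \<kappa> * p * T) * ((LINT \<omega>|M. V N \<omega> powr p) + T * \<kappa> * \<beta>)"
  assumes p: "1 \<le> p" and \<beta>: "\<And>i. i \<le> N \<Longrightarrow> (LINT \<omega>|M. G i \<omega> powr (2 * p)) \<le> \<beta>"
  shows scheme_moment_bound_Y: "i \<le> N \<Longrightarrow>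
      (LINT \<omega>|M. norm (Y i \<omega>) powr (2 * p)) \<le> (4 * (1 + \<kappa>)) powr p * (B + \<beta>)"
    and scheme_moment_bound_Z:
      "(\<Sum>i<N. LINT \<omega>|M. ((norm (Z i \<omega>))\<^sup>2 * h) powr p) \<le> (4 * real CARD('d)) powr p * B"
proof -
  define v where "v i = (LINT \<omega>|M. V i \<omega> powr p)" for i
  define z where "z i = (LINT \<omega>|M. (1/4 * (h * (norm (Z i \<omega>))\<^sup>2 / real CARD('d))) powr p)" for i
  have pos: "0 \<le> v i" "0 \<le> z i" for i by (auto simp: v_def z_def)
  have "0 \<le> (LINT \<omega>|M. G 0 \<omega> powr (2 * p))" by simp
  also have "\<dots> \<le> \<beta>" using \<beta>[of 0] by simp
  finally have \<beta>_pos: "0 \<le> \<beta>" .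
  have step: "v i + z i \<le> exp (2 * (\<kappa> * h) * p) * (v (Suc i) + \<kappa> * h * \<beta>)" if "i < N" for i
  proof -
    have "v i + z i \<le> exp (2 * (\<kappa> * h) * p) * (v (Suc i) + \<kappa> * h * (LINT \<omega>|M. G (Suc i) \<omega> powr (2 * p)))"
      unfolding v_def z_def by (rule energy_moment_step[OF that p])
    also have "\<dots> \<le> exp (2 * (\<kappa> * h) * p) * (v (Suc i) + \<kappa> * h * \<beta>)"
      using \<beta>[of "Suc i"] that kappa_pos h_pos by (intro mult_left_mono add_left_mono) auto
    finally show ?thesis .
  qed
  have Nh: "real N * h = T" using N_pos by (simp add: h_def)
  have gron: "v i + (\<Sum>j=i..<N. z j) \<le> B" if "i \<le> N" for i
  proof -
    have "v i + (\<Sum>j=i..<N. z j) \<le> exp (2 * (\<kappa> * h) * p * real N) * (v N + real N * (\<kappa> * h * \<beta>))"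
      by (rule discrete_backward_gronwall[where v = v and z = z, OF step]) (use that pos \<beta>_pos p kappa_pos h_pos in auto)
    also have "2 * (\<kappa> * h) * p * real N = 2 * \<kappa> * p * (real N * h)" by simp
    also have "real N * (\<kappa> * h * \<beta>) = (real N * h) * \<kappa> * \<beta>" by simp
    finally show ?thesis unfolding Nh by (simp add: B_def v_def)
  qed
  have v_le: "v i \<le> B" if "i \<le> N" for i
  proof -
    have "0 \<le> (\<Sum>j=i..<N. z j)" by (intro sum_nonneg pos)
    with gron[OF that] show ?thesis by linarith
  qed
  show "(LINT \<omega>|M. norm (Y i \<omega>) powr (2 * p)) \<le> (4 * (1 + \<kappa>)) powr p * (B + \<beta>)" if i: "i \<le> N"
  proof -
    let ?c = "(4 * (1 + \<kappa>)) powr p"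
    have iV: "integrable M (\<lambda>\<omega>. V i \<omega> powr p)" and iG: "integrable M (\<lambda>\<omega>. G i \<omega> powr (2 * p))"
      by (intro all_moments_integrable all_moments_powr_nonneg moments_V moments_G V_nonneg G_nonneg i; use p in simp)+
    have "(LINT \<omega>|M. norm (Y i \<omega>) powr (2 * p)) \<le> (LINT \<omega>|M. ?c * (V i \<omega> powr p + G i \<omega> powr (2 * p)))"
    proof (rule integral_mono)
      show "integrable M (\<lambda>\<omega>. norm (Y i \<omega>) powr (2 * p))"
        using moments_YZ[OF i] p by (intro all_moments_integrable all_moments_powr) auto
      show "integrable M (\<lambda>\<omega>. ?c * (V i \<omega> powr p + G i \<omega> powr (2 * p)))"
        using iV iG by simp
      fix \<omega>
      have sq: "(a\<^sup>2) powr p = a powr (2 * p)" if "0 \<le> a" for a :: real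
        using that by (simp add: powr_powr flip: powr_numeral)
      have "0 \<le> h * (norm (Z i \<omega>))\<^sup>2 / real CARD('d)" using h_pos by simp
      then have "(norm (U i \<omega>))\<^sup>2 + h * (norm (Z i \<omega>))\<^sup>2 / real CARD('d) + (G i \<omega>)\<^sup>2
          \<le> 2 * (V i \<omega> + (G i \<omega>)\<^sup>2)"
        using zero_le_power2[of "norm (U i \<omega>)"] zero_le_power2[of "G i \<omega>"]
        unfolding V_def distrib_left by argo
      then have "(1 + \<kappa>) * ((norm (U i \<omega>))\<^sup>2 + h * (norm (Z i \<omega>))\<^sup>2 / real CARD('d) + (G i \<omega>)\<^sup>2)
          \<le> (1 + \<kappa>) * (2 * (V i \<omega> + (G i \<omega>)\<^sup>2))"
        using kappa_pos by (intro mult_left_mono) auto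
      from order_trans[OF driver_le(2)[OF i] this]
      have "(norm (Y i \<omega>))\<^sup>2 \<le> (2 * (1 + \<kappa>)) * (V i \<omega> + (G i \<omega>)\<^sup>2)"
        by (simp only: mult_ac)
      then have "((norm (Y i \<omega>))\<^sup>2) powr p \<le> ((2 * (1 + \<kappa>)) * (V i \<omega> + (G i \<omega>)\<^sup>2)) powr p"
        using p by (intro powr_mono2) auto
      also have "\<dots> = (2 * (1 + \<kappa>)) powr p * (V i \<omega> + (G i \<omega>)\<^sup>2) powr p"
        using kappa_pos V_nonneg by (simp add: powr_mult)
      also have "\<dots> \<le> (2 * (1 + \<kappa>)) powr p * (2 powr p * (V i \<omega> powr p + ((G i \<omega>)\<^sup>2) powr p))"
        using V_nonneg p by (intro mult_left_mono powr_add_le) auto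
      also have "\<dots> = ?c * (V i \<omega> powr p + G i \<omega> powr (2 * p))"
      proof -
        have "(4 * (1 + \<kappa>)) powr p = (2 * (1 + \<kappa>)) powr p * 2 powr p"
          using kappa_pos by (simp flip: powr_mult)
        then show ?thesis using G_nonneg[of i \<omega>] by (simp add: sq)
      qed
      finally show "norm (Y i \<omega>) powr (2 * p) \<le> ?c * (V i \<omega> powr p + G i \<omega> powr (2 * p))"
        by (simp add: sq)
    qed
    also have "\<dots> = ?c * (v i + (LINT \<omega>|M. G i \<omega> powr (2 * p)))"
      using iV iG by (simp add: v_def)
    also have "\<dots> \<le> ?c * (B + \<beta>)"
      using v_le[OF i] \<beta>[OF i] by (intro mult_left_mono add_mono) auto
    finally show ?thesis .
  qed
  have "(LINT \<omega>|M. ((norm (Z i \<omega>))\<^sup>2 * h) powr p) = (4 * real CARD('d)) powr p * z i" for i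
  proof -
    have "((norm (Z i \<omega>))\<^sup>2 * h) powr p =
        (4 * real CARD('d)) powr p * (1/4 * (h * (norm (Z i \<omega>))\<^sup>2 / real CARD('d))) powr p" for \<omega>
    proof -
      have eq: "(norm (Z i \<omega>))\<^sup>2 * h = (4 * real CARD('d)) * (1/4 * (h * (norm (Z i \<omega>))\<^sup>2 / real CARD('d)))"
        by simp
      show ?thesis by (subst eq) (rule powr_mult)
    qed
    then show ?thesis by (simp only: z_def) simp
  qed
  then have "(\<Sum>i<N. LINT \<omega>|M. ((norm (Z i \<omega>))\<^sup>2 * h) powr p) = (4 * real CARD('d)) powr p * (\<Sum>i<N. z i)"
    by (simp add: sum_distrib_left)
  also have "\<dots> \<le> (4 * real CARD('d)) powr p * B"
    using gron[of 0] pos(1)[of 0] by (intro mult_left_mono) (auto simp: atLeast0LessThan)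
  finally show "(\<Sum>i<N. LINT \<omega>|M. ((norm (Z i \<omega>))\<^sup>2 * h) powr p) \<le> (4 * real CARD('d)) powr p * B" .
qed

text \<open>The only place where the growth order \<open>m\<close> of the driver matters quantitatively: with \<open>Z\<^sub>N = 0\<close>
  and \<open>Y\<^sub>N\<close> of linear growth in \<open>s = 1 + |\<xi>\<^sub>N|\<close>, every term of \<open>U\<^sub>N\<close> is at most a multiple of
  \<open>s powr m\<close>.\<close>

lemma terminal_energy_le:
  fixes p C\<^sub>g :: real
  defines "\<Gamma> \<equiv> C\<^sub>g + L + L\<^sub>x + L\<^sub>y * C\<^sub>g powr m"
  assumes p: "1 \<le> p" and Cg: "0 \<le> C\<^sub>g" "\<And>x. norm (g x) \<le> C\<^sub>g * (1 + norm x)"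
  shows "(LINT \<omega>|M. V N \<omega> powr p)
    \<le> \<Gamma> powr (2 * p) * 2 powr (2 * m * p) * (1 + (LINT \<omega>|M. norm (\<xi> N \<omega>) powr (2 * m * p)))"
proof -
  let ?c = "\<Gamma> powr (2 * p) * 2 powr (2 * m * p)"
  have G_pos: "0 \<le> \<Gamma>" using Cg consts_pos by (simp add: \<Gamma>_def)
  have ix: "integrable M (\<lambda>\<omega>. norm (\<xi> N \<omega>) powr (2 * m * p))"
    using p m_ge by (intro all_moments_integrable all_moments_powr forward_moments) auto
  have "(LINT \<omega>|M. V N \<omega> powr p) \<le> (LINT \<omega>|M. ?c * (1 + norm (\<xi> N \<omega>) powr (2 * m * p)))"
  proof (rule integral_mono_AE)
    show "integrable M (\<lambda>\<omega>. V N \<omega> powr p)"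
      using p by (intro all_moments_integrable all_moments_powr_nonneg moments_V V_nonneg) auto
    show "integrable M (\<lambda>\<omega>. ?c * (1 + norm (\<xi> N \<omega>) powr (2 * m * p)))" using ix by simp
    show "AE \<omega> in M. V N \<omega> powr p \<le> ?c * (1 + norm (\<xi> N \<omega>) powr (2 * m * p))"
      using scheme_terminal
    proof eventually_elim
      case (elim \<omega>)
      define s where "s = 1 + norm (\<xi> N \<omega>)"
      have s: "1 \<le> s" by (simp add: s_def)
      have ss: "s \<le> s powr m" using s m_ge powr_mono[of 1 m s] by simp
      have y: "norm (Y N \<omega>) \<le> C\<^sub>g * s" using elim Cg(2) by (simp add: s_def)
      have "norm (\<phi> N \<omega>) \<le> L + L\<^sub>x * norm (\<xi> N \<omega>) + L\<^sub>y * norm (Y N \<omega>) powr m + L\<^sub>z * norm (Z N \<omega>)"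
        using mg tau_in[of N] unfolding \<phi>_def monotone_growth_def by blast
      also have "\<dots> \<le> L * s + L\<^sub>x * s + L\<^sub>y * (C\<^sub>g * s) powr m"
        using elim y consts_pos m_ge
        by (simp, intro add_mono mult_left_mono powr_mono2) (auto simp: s_def mult_le_cancel_left1)
      also have "(C\<^sub>g * s) powr m = C\<^sub>g powr m * s powr m" using Cg s by (simp add: powr_mult)
      finally have \<phi>: "norm (\<phi> N \<omega>) \<le> L * s + L\<^sub>x * s + L\<^sub>y * (C\<^sub>g powr m * s powr m)" .
      have "norm (U N \<omega>) \<le> norm (Y N \<omega>) + norm ((\<theta> * h) *\<^sub>R \<phi> N \<omega>)"
        unfolding U_def by (rule norm_triangle_ineq4)
      also have "\<dots> \<le> C\<^sub>g * s + (L * s + L\<^sub>x * s + L\<^sub>y * (C\<^sub>g powr m * s powr m))"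
      proof (rule add_mono[OF y])
        have "norm ((\<theta> * h) *\<^sub>R \<phi> N \<omega>) \<le> norm (\<phi> N \<omega>)"
          using theta h_pos h_le by (simp add: abs_mult mult_left_le_one_le mult_le_one)
        then show "norm ((\<theta> * h) *\<^sub>R \<phi> N \<omega>) \<le> L * s + L\<^sub>x * s + L\<^sub>y * (C\<^sub>g powr m * s powr m)"
          using \<phi> by (rule order_trans)
      qed
      also have "\<dots> \<le> C\<^sub>g * s powr m + (L * s powr m + L\<^sub>x * s powr m + L\<^sub>y * (C\<^sub>g powr m * s powr m))"
        using ss Cg consts_pos by (intro add_mono mult_left_mono) auto
      also have "\<dots> = \<Gamma> * s powr m" by (simp add: \<Gamma>_def algebra_simps)
      finally have U: "norm (U N \<omega>) \<le> \<Gamma> * s powr m" .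
      have "V N \<omega> powr p = norm (U N \<omega>) powr (2 * p)"
        using elim by (simp add: V_def powr_powr flip: powr_numeral)
      also have "\<dots> \<le> (\<Gamma> * s powr m) powr (2 * p)"
        using U p by (intro powr_mono2) auto
      also have "\<dots> = \<Gamma> powr (2 * p) * s powr (2 * m * p)"
        using G_pos by (simp add: powr_mult powr_powr mult_ac)
      also have "\<dots> \<le> \<Gamma> powr (2 * p) * (2 powr (2 * m * p) * (1 powr (2 * m * p) + norm (\<xi> N \<omega>) powr (2 * m * p)))"
        unfolding s_def using m_ge p by (intro mult_left_mono powr_add_le) auto
      finally show ?case by simp
    qed
  qed
  also have "\<dots> = ?c * (1 + (LINT \<omega>|M. norm (\<xi> N \<omega>) powr (2 * m * p)))"
    using ix by (simp add: prob_space)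
  finally show ?thesis .
qed

lemma forward_growth_moment_le:
  assumes "1 \<le> p" "i \<le> N" and \<beta>: "(LINT \<omega>|M. norm (\<xi> i \<omega>) powr (2 * p)) \<le> \<beta>"
  shows "(LINT \<omega>|M. G i \<omega> powr (2 * p)) \<le> 2 powr (2 * p) * (L powr (2 * p) + L\<^sub>x powr (2 * p) * \<beta>)"
proof -
  have ix: "integrable M (\<lambda>\<omega>. norm (\<xi> i \<omega>) powr (2 * p))"
    using assms by (intro all_moments_integrable all_moments_powr forward_moments) auto
  have "(LINT \<omega>|M. G i \<omega> powr (2 * p)) \<le>
      (LINT \<omega>|M. 2 powr (2 * p) * (L powr (2 * p) + L\<^sub>x powr (2 * p) * norm (\<xi> i \<omega>) powr (2 * p)))"
  proof (rule integral_mono)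
    show "integrable M (\<lambda>\<omega>. G i \<omega> powr (2 * p))"
      using assms by (intro all_moments_integrable all_moments_powr_nonneg moments_G G_nonneg) auto
    show "integrable M (\<lambda>\<omega>. 2 powr (2 * p) * (L powr (2 * p) + L\<^sub>x powr (2 * p) * norm (\<xi> i \<omega>) powr (2 * p)))"
      using ix by simp
    fix \<omega>
    show "G i \<omega> powr (2 * p) \<le> 2 powr (2 * p) * (L powr (2 * p) + L\<^sub>x powr (2 * p) * norm (\<xi> i \<omega>) powr (2 * p))"
      using powr_add_le[of L "L\<^sub>x * norm (\<xi> i \<omega>)" "2 * p"] consts_pos assms
      by (simp add: G_def powr_mult)
  qed
  also have "\<dots> = 2 powr (2 * p) * (L powr (2 * p) + L\<^sub>x powr (2 * p) * (LINT \<omega>|M. norm (\<xi> i \<omega>) powr (2 * p)))"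
    using ix by (simp add: prob_space)
  also have "\<dots> \<le> 2 powr (2 * p) * (L powr (2 * p) + L\<^sub>x powr (2 * p) * \<beta>)"
    using \<beta> by (intro mult_left_mono add_left_mono) auto
  finally show ?thesis .
qed

end

text \<open>The hypothesis controls orders at least \<open>2\<close>; the shift from \<open>n\<close> to \<open>n + 2\<close> covers the lower
  ones.\<close>

lemma (in finite_measure) forward_approximation_all_moments:
  assumes fa: "forward_approximation M (aug_filtration M W) T X Xh"
    and W: "\<And>s. s \<in> {0..T} \<Longrightarrow> W s \<in> borel_measurable M" and "0 \<le> T" "1 \<le> N" "i \<le> N"
  shows "all_moments M (Xh N i)"
  unfolding all_moments_def
proof (intro conjI allI)
  have "grid T N i \<in> {0..T}"
    using assms(3-5) by (auto simp: grid_def field_simps intro: mult_left_mono)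
  then have "subalgebra M (aug_filtration M W (grid T N i))"
    by (intro subalgebra_aug_filtration W) auto
  then show [measurable]: "Xh N i \<in> borel_measurable M"
    using fa assms(4,5) unfolding forward_approximation_def by (blast intro: measurable_from_subalg)
  fix n :: nat
  have "integrable M (\<lambda>\<omega>. norm (Xh N i \<omega>) powr real (n + 2))"
  proof -
    have "2 \<le> real (n + 2)" by simp
    with fa assms(4,5) show ?thesis unfolding forward_approximation_def by blast
  qed
  then have i: "integrable M (\<lambda>\<omega>. 1 + norm (Xh N i \<omega>) powr real (n + 2))" by simp
  show "integrable M (\<lambda>\<omega>. norm (Xh N i \<omega>) ^ n)"
  proof (rule Bochner_Integration.integrable_bound[OF i])
    have "r ^ n \<le> 1 + r powr real (n + 2)" if "0 \<le> r" for r :: real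
    proof (cases "r \<le> 1")
      case True
      then show ?thesis using that by (simp add: power_le_one add_increasing2)
    next
      case False
      then have "r ^ n \<le> r ^ (n + 2)" by (intro power_increasing) auto
      also have "\<dots> = r powr real (n + 2)" using False by (subst powr_realpow) auto
      finally show ?thesis by simp
    qed
    then show "AE \<omega> in M. norm (norm (Xh N i \<omega>) ^ n) \<le> norm (1 + norm (Xh N i \<omega>) powr real (n + 2))"
      by simp
  qed simp
qed

lemma forward_approximation_moment_bound:
  assumes "forward_approximation M F T X Xh" and "2 \<le> q"
  shows "\<exists>c. \<forall>N\<ge>1. \<forall>i\<le>N. (LINT \<omega>|M. norm (Xh N i \<omega>) powr q) \<le> c"
proof -
  obtain \<gamma> :: real where \<gamma>: "\<forall>q\<ge>2. \<exists>c. \<forall>N\<ge>1. \<forall>i\<le>N.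
      integrable M (\<lambda>\<omega>. norm (Xh N i \<omega>) powr q) \<and>
      (LINT \<omega>|M. norm (Xh N i \<omega>) powr q) \<le> c \<and>
      integrable M (\<lambda>\<omega>. norm (X (grid T N i) \<omega> - Xh N i \<omega>) powr q) \<and>
      (LINT \<omega>|M. norm (X (grid T N i) \<omega> - Xh N i \<omega>) powr q) powr (1 / q)
        \<le> c * (T / real N) powr \<gamma>"
    using assms(1) unfolding forward_approximation_def by (elim conjE exE) (rule that)
  from \<gamma>[THEN spec, THEN mp, OF assms(2)] show ?thesis
  proof (elim exE)
    fix c
    assume c: "\<forall>N\<ge>1. \<forall>i\<le>N.
      integrable M (\<lambda>\<omega>. norm (Xh N i \<omega>) powr q) \<and>
      (LINT \<omega>|M. norm (Xh N i \<omega>) powr q) \<le> c \<and>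
      integrable M (\<lambda>\<omega>. norm (X (grid T N i) \<omega> - Xh N i \<omega>) powr q) \<and>
      (LINT \<omega>|M. norm (X (grid T N i) \<omega> - Xh N i \<omega>) powr q) powr (1 / q)
        \<le> c * (T / real N) powr \<gamma>"
    then show ?thesis
      by (intro exI[of _ c] allI impI)
        (rule c[THEN spec, THEN mp, THEN spec, THEN mp, THEN conjunct2, THEN conjunct1])
  qed
qed

theorem proposition5p1:
  fixes M :: "'a measure"
    and W :: "real \<Rightarrow> 'a \<Rightarrow> real^'d"
    and b :: "real \<Rightarrow> real^'d \<Rightarrow> real^'d"
    and \<sigma> :: "real \<Rightarrow> real^'d \<Rightarrow> real^'d^'d"
    and x :: "real^'d"
    and X :: "real \<Rightarrow> 'a \<Rightarrow> real^'d"
    and Xh :: "nat \<Rightarrow> nat \<Rightarrow> 'a \<Rightarrow> real^'d"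
    and g :: "real^'d \<Rightarrow> real^'k"
    and f :: "real \<Rightarrow> real^'d \<Rightarrow> real^'k \<Rightarrow> real^'d^'k \<Rightarrow> real^'k"
    and T m L L\<^sub>t L\<^sub>x L\<^sub>y L\<^sub>z \<theta> p :: real
  assumes "prob_space M" and "complete_measure M"
    and "T > 0"
    and "brownian_motion M T W"
    and "forward_lipschitz T b \<sigma>"
    and "sde_solution M (aug_filtration M W) W T b \<sigma> x X"
    and "m \<ge> 1"
    and "monotone_growth T m L L\<^sub>t L\<^sub>x L\<^sub>y L\<^sub>z g f"
    and "forward_approximation M (aug_filtration M W) T X Xh"
    and "1/2 \<le> \<theta>" and "\<theta> \<le> 1"
    and "p \<ge> 1"
  shows "\<exists>c::real. c \<ge> 0 \<and> (\<forall>N Y Z. N \<ge> 1 \<longrightarrow>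
      T / real N \<le> min 1 (inverse (4 * \<theta> * (L\<^sub>y + 3 * real CARD('d) * \<theta> * L\<^sub>z\<^sup>2))) \<longrightarrow>
      theta_scheme M (aug_filtration M W) W T \<theta> g f N (Xh N) Y Z \<longrightarrow>
      (MAX i\<in>{0..N}. \<integral>\<^sup>+ \<omega>. ennreal (norm (Y i \<omega>) powr (2 * p)) \<partial>M) +
      (\<Sum>i<N. \<integral>\<^sup>+ \<omega>. ennreal (((norm (Z i \<omega>))\<^sup>2 * (T / real N)) powr p) \<partial>M)
        \<le> ennreal c * (1 + (\<integral>\<^sup>+ \<omega>. ennreal (norm (Xh N N \<omega>) powr (2 * m * p)) \<partial>M)))"
proof -
  interpret prob_space M by fact
  have coeffs: "L > 0" "L\<^sub>x > 0" "L\<^sub>y > 0" "L\<^sub>z > 0"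
    using assms(8) by (simp_all add: monotone_growth_def)
  obtain \<beta> where \<beta>: "\<And>N i. 1 \<le> N \<Longrightarrow> i \<le> N \<Longrightarrow> (LINT \<omega>|M. norm (Xh N i \<omega>) powr (2 * p)) \<le> \<beta>"
  proof -
    have "2 \<le> 2 * p" using assms(12) by simp
    from forward_approximation_moment_bound[OF assms(9) this] that show thesis by blast
  qed
  have "0 \<le> (LINT \<omega>|M. norm (Xh 1 0 \<omega>) powr (2 * p))" by simp
  also have "\<dots> \<le> \<beta>" by (rule \<beta>) auto
  finally have \<beta>_pos: "0 \<le> \<beta>" .
  obtain Lg where Lg: "Lg-lipschitz_on UNIV g" using assms(8) by (auto simp: monotone_growth_def)
  define C\<^sub>g where "C\<^sub>g = norm (g 0) + Lg"
  have Lg_pos: "0 \<le> Lg" using Lg by (rule lipschitz_on_nonneg)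
  have Cg: "0 \<le> C\<^sub>g" "norm (g x) \<le> C\<^sub>g * (1 + norm x)" for x
  proof -
    show "0 \<le> C\<^sub>g" using Lg_pos by (simp add: C\<^sub>g_def)
    note lipschitz_linear_growth[OF Lg, of x]
    also have "norm (g 0) + Lg * norm x \<le> C\<^sub>g * (1 + norm x)"
      using Lg_pos by (simp add: C\<^sub>g_def algebra_simps)
    finally show "norm (g x) \<le> C\<^sub>g * (1 + norm x)" by simp
  qed
  define \<kappa> where "\<kappa> = energy_const (real CARD('d)) \<theta> L\<^sub>y L\<^sub>z"
  have \<kappa>_pos: "0 \<le> \<kappa>"
    using coeffs assms(10) by (simp add: \<kappa>_def energy_const_def)
  define \<beta>' where "\<beta>' = 2 powr (2 * p) * (L powr (2 * p) + L\<^sub>x powr (2 * p) * \<beta>)"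
  have \<beta>'_pos: "0 \<le> \<beta>'" using \<beta>_pos by (simp add: \<beta>'_def)
  define c\<^sub>V where "c\<^sub>V = (C\<^sub>g + L + L\<^sub>x + L\<^sub>y * C\<^sub>g powr m) powr (2 * p) * 2 powr (2 * m * p)"
  define c\<^sub>B where "c\<^sub>B = exp (2 * \<kappa> * p * T) * (c\<^sub>V + T * \<kappa> * \<beta>')"
  have cV_pos: "0 \<le> c\<^sub>V" by (simp add: c\<^sub>V_def)
  have cB_pos: "0 \<le> c\<^sub>B" using cV_pos \<kappa>_pos \<beta>'_pos assms(3) by (simp add: c\<^sub>B_def)
  define c where "c = (4 * (1 + \<kappa>)) powr p * (c\<^sub>B + \<beta>') + (4 * real CARD('d)) powr p * c\<^sub>B"
  have c_pos: "0 \<le> c" using cB_pos \<beta>'_pos by (simp add: c_def)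
  show ?thesis
  proof (intro exI[of _ c] conjI allI impI c_pos)
    fix N Y Z
    assume N: "N \<ge> 1"
      and h_le: "T / real N \<le> min 1 (inverse (4 * \<theta> * (L\<^sub>y + 3 * real CARD('d) * \<theta> * L\<^sub>z\<^sup>2)))"
      and scheme: "theta_scheme M (aug_filtration M W) W T \<theta> g f N (Xh N) Y Z"
    have W: "W s \<in> borel_measurable M" if "s \<in> {0..T}" for s
      using assms(4) that by (simp add: brownian_motion_def)
    let ?D = "4 * \<theta> * (L\<^sub>y + 3 * real CARD('d) * \<theta> * L\<^sub>z\<^sup>2)"
    have D_pos: "0 < ?D" using coeffs assms(10) by (simp add: add_pos_nonneg)
    have "?D * (T / real N) \<le> ?D * inverse ?D"
      using h_le D_pos by (intro mult_left_mono) auto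
    also have "\<dots> = 1" by (rule right_inverse[OF less_imp_neq[OF D_pos, THEN not_sym]])
    finally have small: "?D * (T / real N) \<le> 1" .
    interpret S: theta_scheme_output M W "Xh N" g f T m L L\<^sub>t L\<^sub>x L\<^sub>y L\<^sub>z \<theta> N Y Z
      using assms N h_le small scheme W
      by unfold_locales (auto intro: forward_approximation_all_moments)
    have \<kappa>: "S.\<kappa> = \<kappa>" by (simp add: S.\<kappa>_def \<kappa>_def)
    define \<Xi> where "\<Xi> = 1 + (LINT \<omega>|M. norm (Xh N N \<omega>) powr (2 * m * p))"
    have \<Xi>: "1 \<le> \<Xi>" by (simp add: \<Xi>_def)
    let ?B = "exp (2 * S.\<kappa> * p * T) * ((LINT \<omega>|M. S.V N \<omega> powr p) + T * S.\<kappa> * \<beta>')"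
    have scale: "a \<le> a * \<Xi>" if "0 \<le> a" for a using mult_left_mono[OF \<Xi> that] by simp
    have B: "?B \<le> c\<^sub>B * \<Xi>"
    proof -
      have "(LINT \<omega>|M. S.V N \<omega> powr p) \<le> c\<^sub>V * \<Xi>"
        unfolding c\<^sub>V_def \<Xi>_def by (rule S.terminal_energy_le[OF assms(12) Cg])
      moreover have "T * \<kappa> * \<beta>' \<le> T * \<kappa> * \<beta>' * \<Xi>"
        using assms(3) \<kappa>_pos \<beta>'_pos by (intro scale) auto
      ultimately have "(LINT \<omega>|M. S.V N \<omega> powr p) + T * \<kappa> * \<beta>' \<le> (c\<^sub>V + T * \<kappa> * \<beta>') * \<Xi>"
        unfolding distrib_right by (rule add_mono)
      then show ?thesis unfolding \<kappa> c\<^sub>B_def mult.assoc[of "exp _"] by (intro mult_left_mono) auto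
    qed
    have G: "(LINT \<omega>|M. S.G i \<omega> powr (2 * p)) \<le> \<beta>'" if "i \<le> N" for i
      unfolding \<beta>'_def by (rule S.forward_growth_moment_le[OF assms(12) that \<beta>[OF N that]])
    have Y: "(\<integral>\<^sup>+ \<omega>. ennreal (norm (Y i \<omega>) powr (2 * p)) \<partial>M)
        \<le> ennreal ((4 * (1 + \<kappa>)) powr p * (c\<^sub>B + \<beta>') * \<Xi>)" if i: "i \<le> N" for i
    proof -
      have "integrable M (\<lambda>\<omega>. norm (Y i \<omega>) powr (2 * p))"
        using S.moments_YZ[OF i] assms(12) by (intro all_moments_integrable all_moments_powr) auto
      then have "(\<integral>\<^sup>+ \<omega>. ennreal (norm (Y i \<omega>) powr (2 * p)) \<partial>M)
          = ennreal (LINT \<omega>|M. norm (Y i \<omega>) powr (2 * p))"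
        by (intro nn_integral_eq_integral) auto
      also have "\<dots> \<le> ennreal ((4 * (1 + \<kappa>)) powr p * (?B + \<beta>'))"
        using S.scheme_moment_bound_Y[OF assms(12) G i] unfolding \<kappa> by (rule ennreal_leI)
      also have "\<dots> \<le> ennreal ((4 * (1 + \<kappa>)) powr p * ((c\<^sub>B + \<beta>') * \<Xi>))"
        using B scale[OF \<beta>'_pos] by (intro ennreal_leI mult_left_mono) (auto simp: distrib_right)
      finally show ?thesis by (simp add: mult.assoc)
    qed
    have Z: "(\<Sum>i<N. \<integral>\<^sup>+ \<omega>. ennreal (((norm (Z i \<omega>))\<^sup>2 * (T / real N)) powr p) \<partial>M)
        \<le> ennreal ((4 * real CARD('d)) powr p * c\<^sub>B * \<Xi>)"
    proof -
      have "(\<integral>\<^sup>+ \<omega>. ennreal (((norm (Z i \<omega>))\<^sup>2 * (T / real N)) powr p) \<partial>M) =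
          ennreal (LINT \<omega>|M. ((norm (Z i \<omega>))\<^sup>2 * S.h) powr p)" if "i < N" for i
      proof -
        have mom: "all_moments M (\<lambda>\<omega>. (norm (Z i \<omega>) * norm (Z i \<omega>)) * S.h)"
          using S.moments_YZ[of i] that
          by (intro all_moments_mult all_moments_norm all_moments_const) auto
        have "integrable M (\<lambda>\<omega>. ((norm (Z i \<omega>) * norm (Z i \<omega>)) * S.h) powr p)"
          using S.h_pos assms(12) by (intro all_moments_integrable all_moments_powr_nonneg[OF mom]) auto
        then show ?thesis
          unfolding S.h_def[symmetric] power2_eq_square by (intro nn_integral_eq_integral) auto
      qed
      then have "(\<Sum>i<N. \<integral>\<^sup>+ \<omega>. ennreal (((norm (Z i \<omega>))\<^sup>2 * (T / real N)) powr p) \<partial>M) =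
          ennreal (\<Sum>i<N. LINT \<omega>|M. ((norm (Z i \<omega>))\<^sup>2 * S.h) powr p)"
        by (simp add: sum_ennreal)
      also have "\<dots> \<le> ennreal ((4 * real CARD('d)) powr p * ?B)"
        by (intro ennreal_leI S.scheme_moment_bound_Z[OF assms(12) G])
      also have "\<dots> \<le> ennreal ((4 * real CARD('d)) powr p * (c\<^sub>B * \<Xi>))"
        using B by (intro ennreal_leI mult_left_mono) auto
      finally show ?thesis by (simp add: mult.assoc)
    qed
    have "(MAX i\<in>{0..N}. \<integral>\<^sup>+ \<omega>. ennreal (norm (Y i \<omega>) powr (2 * p)) \<partial>M)
        \<le> ennreal ((4 * (1 + \<kappa>)) powr p * (c\<^sub>B + \<beta>') * \<Xi>)"
      using Y by (intro Max.boundedI) auto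
    from add_mono[OF this Z]
    have "(MAX i\<in>{0..N}. \<integral>\<^sup>+ \<omega>. ennreal (norm (Y i \<omega>) powr (2 * p)) \<partial>M) +
        (\<Sum>i<N. \<integral>\<^sup>+ \<omega>. ennreal (((norm (Z i \<omega>))\<^sup>2 * (T / real N)) powr p) \<partial>M)
        \<le> ennreal ((4 * (1 + \<kappa>)) powr p * (c\<^sub>B + \<beta>') * \<Xi>) + ennreal ((4 * real CARD('d)) powr p * c\<^sub>B * \<Xi>)" .
    also have "\<dots> = ennreal (c * \<Xi>)"
      using cB_pos \<beta>'_pos \<Xi> by (simp add: c_def distrib_right flip: ennreal_plus)
    also have "\<dots> = ennreal c * (1 + (\<integral>\<^sup>+ \<omega>. ennreal (norm (Xh N N \<omega>) powr (2 * m * p)) \<partial>M))"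
    proof -
      have "integrable M (\<lambda>\<omega>. norm (Xh N N \<omega>) powr (2 * m * p))"
        using assms(7,12) by (intro all_moments_integrable all_moments_powr S.forward_moments) auto
      then have "(\<integral>\<^sup>+ \<omega>. ennreal (norm (Xh N N \<omega>) powr (2 * m * p)) \<partial>M)
          = ennreal (LINT \<omega>|M. norm (Xh N N \<omega>) powr (2 * m * p))"
        by (intro nn_integral_eq_integral) auto
      then show ?thesis using c_pos by (simp add: \<Xi>_def ennreal_mult)
    qed
    finally show "(MAX i\<in>{0..N}. \<integral>\<^sup>+ \<omega>. ennreal (norm (Y i \<omega>) powr (2 * p)) \<partial>M) +
      (\<Sum>i<N. \<integral>\<^sup>+ \<omega>. ennreal (((norm (Z i \<omega>))\<^sup>2 * (T / real N)) powr p) \<partial>M)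
        \<le> ennreal c * (1 + (\<integral>\<^sup>+ \<omega>. ennreal (norm (Xh N N \<omega>) powr (2 * m * p)) \<partial>M))" .
  qed
qed

end
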